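(* Let $U$ and $V$ be open sets in $\mathbb{R}^N$ with non-empty intersection $W=U\cap V$. If $F\in\mathscr{B}(U)$, $G\in\mathscr{B}(V)$, and $F=G$ on $W$ (that is, $F|_W=G|_W$), then there is a Boehmian $H\in\mathscr{B}(U\cup V)$ such that $H|_U=F$ and $H|_V=G$.
   Context: Notation. $K\Subset U$ means that $K$ is a compact subset of the open set $U\subseteq\mathbb{R}^N$. $\mathscr{C}(U)$ is the space of continuous (real-valued) functions on $U$. $B_\varepsilon$ is the ball of radius $\varepsilon$ centered at the origin. $\mathscr{D}_o$ is the set of smooth compactly supported functions $\varphi$ on $\mathbb{R}^N$ with $\varphi\ge 0$ and $\int\varphi=1$; $s(\varphi)=\inf\{\varepsilon>0:\operatorname{supp}\varphi\subset B_\varepsilon\}$. A delta sequence is a sequence $(\varphi_n)$ in $\mathscr{D}_o$ with $s(\varphi_n)\to0$; $\Delta$ is the set of all delta sequences. $f_n\rightrightarrows f$ on $S$ means uniform convergence on $S$. Convolution. $(f*\varphi)(x)=\int f(y)\varphi(x-y)\,dy$, where for $f$ defined only on an open set $U$ the product $f(y)\varphi(x-y)$ is taken to be $0$ whenever $\varphi(x-y)=0$, even if $f$ is not defined at $y$. Convention: if $K\Subset U$ and $(\delta_m)\in\Delta$, then for all but finitely many $m$ the convolutions $f*\delta_m$ with $f\in\mathscr{C}(U)$ are defined on all of $K$; the finitely many indices for which they are not are ignored in statements about convergence on $K$. Boehmians. A sequence $(f_n)$ in $\mathscr{C}(U)$ ($U$ open) is fundamental if for every $K\Subset U$ there is $(\delta_n)\in\Delta$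 such that, for every $m\in\mathbb{N}$, the sequence $(f_n*\delta_m)_n$ converges uniformly on $K$ as $n\to\infty$. $\mathscr{A}(U)$ is the set of fundamental sequences on $U$. For $(f_n),(g_n)\in\mathscr{A}(U)$, $(f_n)\sim(g_n)$ means that for every $K\Subset U$ there is $(\varphi_n)\in\Delta$ such that, for each $m$, $(f_n-g_n)*\varphi_m\rightrightarrows0$ on $K$ as $n\to\infty$. This is an equivalence relation, and $\mathscr{B}(U)=\mathscr{A}(U)/\sim$ is the space of Boehmians on $U$; the class of $(f_n)$ is denoted $[(f_n)]$. For open $V\subseteq U$ and $F=[(f_n)]\in\mathscr{B}(U)$, the restriction is $F|_V=[(f_n|_V)]\in\mathscr{B}(V)$, which is well defined. *)

theory Defs
  imports "HOL-Analysis.Analysis"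
begin

text \<open>
  Functions of class $C^k$ on the whole space. In finite dimension, being differentiable
  everywhere with all directional derivatives of class $C^{k-1}$ is the same as being
  of class $C^k$.
\<close>

primrec class_C :: "nat \<Rightarrow> ('a::euclidean_space \<Rightarrow> real) \<Rightarrow> bool" where
  "class_C 0 f \<longleftrightarrow> continuous_on UNIV f"
| "class_C (Suc k) f \<longleftrightarrow>
     (\<exists>f'. (\<forall>x. (f has_derivative f' x) (at x)) \<and> (\<forall>v. class_C k (\<lambda>x. f' x v)))"

definition smooth :: "('a::euclidean_space \<Rightarrow> real) \<Rightarrow> bool" where
  "smooth f \<longleftrightarrow> (\<forall>k. class_C k f)"

definition supp :: "('a::euclidean_space \<Rightarrow> real) \<Rightarrow> 'a set" where
  "supp f = closure {x. f x \<noteq> 0}"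

definition test_functions :: "('a::euclidean_space \<Rightarrow> real) set" where
  "test_functions =
     {\<phi>. smooth \<phi> \<and> compact (supp \<phi>) \<and> (\<forall>x. 0 \<le> \<phi> x) \<and> integral\<^sup>L lborel \<phi> = 1}"

definition supp_radius :: "('a::euclidean_space \<Rightarrow> real) \<Rightarrow> real" where
  "supp_radius \<phi> = Inf {\<epsilon>. 0 < \<epsilon> \<and> supp \<phi> \<subseteq> ball 0 \<epsilon>}"

definition delta_sequences :: "(nat \<Rightarrow> 'a::euclidean_space \<Rightarrow> real) set" where
  "delta_sequences =
     {\<delta>. (\<forall>n. \<delta> n \<in> test_functions) \<and> (\<lambda>n. supp_radius (\<delta> n)) \<longlonglongrightarrow> 0}"

text \<open>
  A function defined on \<open>U\<close> only is a total function that is \<^const>\<open>undefined\<close>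
  off \<open>U\<close>, so that equality of functions is equality on \<open>U\<close>.
\<close>

definition cont_functions :: "'a::euclidean_space set \<Rightarrow> ('a \<Rightarrow> real) set" where
  "cont_functions U = {f \<in> extensional U. continuous_on U f}"

text \<open>
  Multiplication by \<open>0\<close> yields \<open>0\<close> even at points \<open>y\<close> where \<open>f\<close> is
  \<^const>\<open>undefined\<close>. The value is meaningful only under \<open>conv_defined\<close> below.
\<close>

definition conv :: "('a::euclidean_space \<Rightarrow> real) \<Rightarrow> ('a \<Rightarrow> real) \<Rightarrow> 'a \<Rightarrow> real" where
  "conv f \<phi> x = (\<integral>y. f y * \<phi> (x - y) \<partial>lborel)"

text \<open>
  The convolutions with \<open>\<phi>\<close> of all continuous functions on \<open>U\<close> are defined on \<open>K\<close>:
  the integrand uses values of \<open>f\<close> only at points of \<open>U\<close>, and the integral exists.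
  For compact \<open>K \<subseteq> U\<close>, all but finitely many terms of a delta sequence satisfy this.
\<close>

definition conv_defined :: "'a::euclidean_space set \<Rightarrow> 'a set \<Rightarrow> ('a \<Rightarrow> real) \<Rightarrow> bool" where
  "conv_defined U K \<phi> \<longleftrightarrow>
     (\<forall>f\<in>cont_functions U. \<forall>x\<in>K.
        (\<forall>y. \<phi> (x - y) \<noteq> 0 \<longrightarrow> y \<in> U) \<and> integrable lborel (\<lambda>y. f y * \<phi> (x - y)))"

definition fundamental_sequences ::
    "'a::euclidean_space set \<Rightarrow> (nat \<Rightarrow> 'a \<Rightarrow> real) set" where
  "fundamental_sequences U =
     {f. (\<forall>n. f n \<in> cont_functions U) \<and>
         (\<forall>K. compact K \<and> K \<subseteq> U \<longrightarrow>
            (\<exists>\<delta>\<in>delta_sequences. \<forall>m. conv_defined U K (\<delta> m) \<longrightarrow>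
               uniformly_convergent_on K (\<lambda>n. conv (f n) (\<delta> m))))}"

definition boehmian_rel ::
    "'a::euclidean_space set \<Rightarrow> ((nat \<Rightarrow> 'a \<Rightarrow> real) \<times> (nat \<Rightarrow> 'a \<Rightarrow> real)) set" where
  "boehmian_rel U =
     {(f, g). f \<in> fundamental_sequences U \<and> g \<in> fundamental_sequences U \<and>
        (\<forall>K. compact K \<and> K \<subseteq> U \<longrightarrow>
           (\<exists>\<phi>\<in>delta_sequences. \<forall>m. conv_defined U K (\<phi> m) \<longrightarrow>
              uniform_limit K (\<lambda>n. conv (\<lambda>y. f n y - g n y) (\<phi> m)) (\<lambda>_. 0) sequentially))}"

definition boehmians :: "'a::euclidean_space set \<Rightarrow> (nat \<Rightarrow> 'a \<Rightarrow> real) set set" where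
  "boehmians U = fundamental_sequences U // boehmian_rel U"

text \<open>
  The common class in \<open>boehmians V\<close> of the restrictions to \<open>V\<close> of all representatives of
  \<open>F\<close>; for open \<open>V \<subseteq> U\<close> and \<open>F\<close> in \<open>boehmians U\<close> it does not depend on the
  representative, so the union is over equal sets.
\<close>

definition restrict_boehmian ::
    "'a::euclidean_space set \<Rightarrow> (nat \<Rightarrow> 'a \<Rightarrow> real) set \<Rightarrow> (nat \<Rightarrow> 'a \<Rightarrow> real) set" where
  "restrict_boehmian V F = (\<Union>f\<in>F. boehmian_rel V `` {\<lambda>n. restrict (f n) V})"

end

theory Submission
  imports Defs
begin

text \<open>
  Representatives of \<open>F\<close> and \<open>G\<close> need not be close to each other on \<open>U \<inter> V\<close>; only
  their smoothings are, and cutting off does not commute with smoothing. What does glue is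
  the smoothings. If \<open>f\<close> represents \<open>F\<close> and the sequence of the \<open>conv (f k) \<phi>\<close> converges
  uniformly on a compact set, the limit is an honest continuous function there, to be
  thought of as \<open>F * \<phi>\<close>. If \<open>F\<close> and \<open>G\<close> agree on \<open>U \<inter> V\<close>, then \<open>F * \<phi>\<close> and
  \<open>G * \<phi>\<close> are equal on the overlap of their domains, for suitable \<open>\<phi>\<close>, and therefore
  define one continuous function.

  Any finite number of requirements on \<open>\<phi>\<close> of the form "smoothing by \<open>\<phi>\<close> converges on a
  given compact set" can be met together, by convolving mollifiers that meet one
  requirement each: convergence is preserved under further smoothing
  (\<open>uniform_limit_conv_conv\<close>). Take compact sets \<open>C n\<close> exhausting \<open>U\<close> and \<open>D n\<close>
  exhausting \<open>V\<close>, and mollifiers \<open>\<phi> n\<close> with radii tending to \<open>0\<close> such that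
  \<open>F * \<phi> n\<close> exists on \<open>C n\<close>, \<open>G * \<phi> n\<close> on \<open>D n\<close>, and both are equal on
  \<open>C n \<inter> D n\<close>. Let \<open>h n\<close> be a continuous function on \<open>U \<union> V\<close> extending both
  (\<open>common_regularization\<close>).

  The sequence \<open>h\<close> represents \<open>F\<close> on \<open>U\<close> (\<open>diagonal_equivalent\<close>): if \<open>F * \<psi>\<close>
  exists near a compact subset of \<open>U\<close>, then for large \<open>n\<close> the smoothing of \<open>h n\<close> by
  \<open>\<psi>\<close> is \<open>(F * \<phi> n) * \<psi> = (F * \<psi>) * \<phi> n\<close>, which tends to \<open>F * \<psi>\<close>
  (\<open>uniform_limit_conv_diagonal\<close>). In the same way \<open>h\<close> represents \<open>G\<close> on \<open>V\<close>, and a sequence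
  that is fundamental on \<open>U\<close> and on \<open>V\<close> is fundamental on \<open>U \<union> V\<close>
  (\<open>fundamental_sequences_Un\<close>).

  Throughout, "for some delta sequence, each of its terms" is replaced by "for each radius,
  some mollifier" (\<open>ex_delta_sequence_iff\<close>), and convolutions of functions that are
  continuous near a compact set only are reduced to convolutions of continuous functions on
  the whole space.
\<close>

section \<open>Convolution of continuous functions\<close>

lemma class_C_continuous: "class_C k f \<Longrightarrow> continuous_on UNIV f"
proof (cases k)
  case (Suc j)
  assume "class_C k f"
  with Suc obtain f' where "\<forall>x. (f has_derivative f' x) (at x)" by auto
  then show ?thesis
    by (meson continuous_at_imp_continuous_on has_derivative_continuous)
qed simp

lemma integrable_compact_support:
  fixes f :: "'a::euclidean_space \<Rightarrow> real"
  assumes "continuous_on UNIV f" "compact S" "\<And>x. x \<notin> S \<Longrightarrow> f x = 0"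
  shows "integrable lborel f"
proof -
  have "(\<lambda>x. indicator S x *\<^sub>R f x) = f"
    using assms(3) by (fastforce simp: indicator_def)
  with borel_integrable_compact[OF assms(2) continuous_on_subset[OF assms(1)]]
  show ?thesis by simp
qed

lemma integral_translate:
  fixes f :: "'a::euclidean_space \<Rightarrow> real"
  assumes "continuous_on UNIV f"
  shows "(\<integral>y. f (c + y) \<partial>lborel) = (\<integral>y. f y \<partial>lborel)"
proof -
  have m: "f \<in> borel_measurable borel"
    using assms by (rule borel_measurable_continuous_onI)
  have "(\<integral>y. f y \<partial>lborel) = (\<integral>y. f y \<partial>distr lborel borel ((+) c))"
    by (simp add: lborel_distr_plus)
  also have "\<dots> = (\<integral>y. f (c + y) \<partial>lborel)"
    by (rule integral_distr) (use m in auto)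
  finally show ?thesis by simp
qed

lemma integral_reflect:
  fixes f :: "'a::euclidean_space \<Rightarrow> real"
  assumes "continuous_on UNIV f"
  shows "(\<integral>y. f (c - y) \<partial>lborel) = (\<integral>y. f y \<partial>lborel)"
proof -
  have m: "f \<in> borel_measurable borel"
    using assms by (rule borel_measurable_continuous_onI)
  have "(lborel :: 'a measure) = distr lborel borel (\<lambda>y. c - y)"
    by (subst lborel_affine[of "-1" c]) (auto simp: density_1)
  then have "(\<integral>y. f y \<partial>lborel) = (\<integral>y. f y \<partial>distr lborel borel (\<lambda>y. c - y))"
    by simp
  also have "\<dots> = (\<integral>y. f (c - y) \<partial>lborel)"
    by (rule integral_distr) (use m in auto)
  finally show ?thesis by simp
qed

lemma conv_commute:
  assumes "continuous_on UNIV f" "continuous_on UNIV \<phi>"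
  shows "conv f \<phi> = conv \<phi> f"
proof
  fix x
  have "continuous_on UNIV (\<lambda>y. f y * \<phi> (x - y))"
    by (intro continuous_intros assms(1) continuous_on_compose2[OF assms(2)]) auto
  from integral_reflect[OF this, of x] show "conv f \<phi> x = conv \<phi> f x"
    by (simp add: conv_def mult.commute)
qed

lemma conv_eq_integral_cbox:
  assumes "continuous_on UNIV \<phi>" "\<And>y. y \<notin> cbox a b \<Longrightarrow> \<phi> y = 0" "continuous_on UNIV f"
  shows "conv \<phi> f x = integral (cbox a b) (\<lambda>y. \<phi> y * f (x - y))"
proof -
  have c: "continuous_on UNIV (\<lambda>y. \<phi> y * f (x - y))"
    by (intro continuous_intros assms(1) continuous_on_compose2[OF assms(3)]) auto
  have "integrable lborel (\<lambda>y. \<phi> y * f (x - y))"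
    by (rule integrable_compact_support[OF c compact_cbox[of a b]]) (use assms(2) in auto)
  then have "conv \<phi> f x = integral UNIV (\<lambda>y. \<phi> y * f (x - y))"
    by (simp add: conv_def integral_lborel)
  also have "\<dots> = integral (cbox a b) (\<lambda>y. \<phi> y * f (x - y))"
    by (subst integral_restrict_UNIV[symmetric], rule arg_cong[where f="integral UNIV"])
       (use assms(2) in auto)
  finally show ?thesis .
qed

lemma continuous_on_conv:
  assumes "continuous_on UNIV \<phi>" "\<And>y. y \<notin> cbox a b \<Longrightarrow> \<phi> y = 0" "continuous_on UNIV f"
  shows "continuous_on UNIV (conv \<phi> f)"
proof -
  have "continuous_on (UNIV \<times> cbox a b) (\<lambda>(x, y). \<phi> y * f (x - y))"
    unfolding split_beta
    by (intro continuous_intros continuous_on_compose2[OF assms(1)] continuous_on_compose2[OF assms(3)]) auto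
  from integral_continuous_on_param[OF this] show ?thesis
    by (simp add: conv_eq_integral_cbox[OF assms] fun_eq_iff[symmetric] cong: continuous_on_cong)
qed

text \<open>
  The derivative falls on \<open>f\<close> under the integral sign, which the support of
  \<open>\<phi>\<close> confines to a box. The directional derivatives of the convolution are again
  convolutions with \<open>\<phi>\<close>, now of the directional derivatives of \<open>f\<close>, and the induction
  hypothesis applies to them.
\<close>

lemma class_C_conv:
  assumes "continuous_on UNIV \<phi>" "\<And>y. y \<notin> cbox a b \<Longrightarrow> \<phi> y = 0" "class_C k f"
  shows "class_C k (conv \<phi> f)"
  using assms(3)
proof (induction k arbitrary: f)
  case 0
  then show ?case using continuous_on_conv[OF assms(1,2)] by simp
next
  case (Suc k)
  then obtain f' where f': "\<And>x. (f has_derivative f' x) (at x)" and ck: "\<And>v. class_C k (\<lambda>x. f' x v)"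
    by auto
  have contf: "continuous_on UNIV f" using Suc.prems by (rule class_C_continuous)
  \<comment> \<open>the total derivative as a bounded linear map, continuous because each directional
    derivative is\<close>
  define D where "D x = Blinfun (f' x)" for x
  have D: "blinfun_apply (D x) = f' x" for x
    unfolding D_def using f' by (intro bounded_linear_Blinfun_apply) (auto dest: has_derivative_bounded_linear)
  have contD: "continuous_on UNIV D"
    by (rule continuous_on_blinfun_componentwise) (simp add: D class_C_continuous[OF ck])
  have contI: "continuous_on (UNIV \<times> cbox a b) (\<lambda>(x, y). \<phi> y *\<^sub>R D (x - y))"
    unfolding split_beta
    by (intro continuous_intros continuous_on_compose2[OF assms(1)] continuous_on_compose2[OF contD]) auto
  have der: "(conv \<phi> f has_derivative integral (cbox a b) (\<lambda>y. \<phi> y *\<^sub>R D (x - y))) (at x)" for x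
  proof -
    have "((\<lambda>x. integral (cbox a b) (\<lambda>y. \<phi> y * f (x - y))) has_derivative
        integral (cbox a b) (\<lambda>y. \<phi> y *\<^sub>R D (x - y))) (at x within UNIV)"
    proof (rule leibniz_rule[OF _ _ contI])
      fix x y
      show "((\<lambda>x. \<phi> y * f (x - y)) has_derivative blinfun_apply (\<phi> y *\<^sub>R D (x - y))) (at x within UNIV)"
        by (auto intro!: derivative_eq_intros has_derivative_compose[OF _ f'] simp: D scaleR_blinfun.rep_eq)
    next
      fix x
      have "continuous_on UNIV (\<lambda>y. \<phi> y * f (x - y))"
        by (intro continuous_intros assms(1) continuous_on_compose2[OF contf]) auto
      then show "(\<lambda>y. \<phi> y * f (x - y)) integrable_on cbox a b"
        by (meson integrable_continuous continuous_on_subset subset_UNIV)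
    qed auto
    moreover have "conv \<phi> f = (\<lambda>x. integral (cbox a b) (\<lambda>y. \<phi> y * f (x - y)))"
      by (rule ext) (rule conv_eq_integral_cbox[OF assms(1,2) contf])
    ultimately show ?thesis by simp
  qed
  have "integral (cbox a b) (\<lambda>y. \<phi> y *\<^sub>R D (x - y)) v = conv \<phi> (\<lambda>z. f' z v) x" for x v
  proof -
    have "continuous_on (cbox a b) (\<lambda>y. \<phi> y *\<^sub>R D (x - y))"
      by (intro continuous_intros continuous_on_compose2[OF assms(1)] continuous_on_compose2[OF contD]) auto
    then have "(\<lambda>y. \<phi> y *\<^sub>R D (x - y)) integrable_on cbox a b"
      by (rule integrable_continuous)
    then have "integral (cbox a b) (\<lambda>y. \<phi> y *\<^sub>R D (x - y)) v =
        integral (cbox a b) (\<lambda>y. (\<phi> y *\<^sub>R D (x - y)) v)"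
      by (rule blinfun_apply_integral)
    then show ?thesis
      by (simp add: D scaleR_blinfun.rep_eq conv_eq_integral_cbox[OF assms(1,2) class_C_continuous[OF ck]])
  qed
  then have "class_C k (\<lambda>x. integral (cbox a b) (\<lambda>y. \<phi> y *\<^sub>R D (x - y)) v)" for v
    using Suc.IH[OF ck[of v]] by simp
  with der show ?case
    unfolding class_C.simps
    by (intro exI[of _ "\<lambda>x. blinfun_apply (integral (cbox a b) (\<lambda>y. \<phi> y *\<^sub>R D (x - y)))"]) simp
qed

text \<open>
  Fubini's theorem, applicable because the two factors \<open>\<phi>\<close> and \<open>\<psi>\<close> with bounded
  support make the double integrand vanish off a compact set.
\<close>

lemma conv_assoc:
  assumes f: "continuous_on UNIV f" and p: "continuous_on UNIV \<phi>" and q: "continuous_on UNIV \<psi>"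
    and pr: "\<And>y. \<phi> y \<noteq> 0 \<Longrightarrow> norm y \<le> r" and qs: "\<And>y. \<psi> y \<noteq> 0 \<Longrightarrow> norm y \<le> s"
  shows "conv (conv f \<phi>) \<psi> x = conv f (conv \<phi> \<psi>) x"
proof -
  let ?F = "\<lambda>z y. f z * \<phi> (y - z) * \<psi> (x - y)"
  have int: "integrable (lborel \<Otimes>\<^sub>M lborel) (case_prod ?F)"
    unfolding lborel_prod
  proof (rule integrable_compact_support)
    show "continuous_on UNIV (case_prod ?F)"
      unfolding split_beta
      by (intro continuous_intros continuous_on_compose2[OF f] continuous_on_compose2[OF p] continuous_on_compose2[OF q]) auto
    show "compact (cball x (r + s) \<times> cball x s)" by (intro compact_Times compact_cball)
    fix u assume u: "u \<notin> cball x (r + s) \<times> cball x s"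
    obtain z y where zy: "u = (z, y)" by fastforce
    have "\<not> (\<phi> (y - z) \<noteq> 0 \<and> \<psi> (x - y) \<noteq> 0)"
    proof
      assume "\<phi> (y - z) \<noteq> 0 \<and> \<psi> (x - y) \<noteq> 0"
      then have a: "norm (y - z) \<le> r" "norm (x - y) \<le> s" using pr qs by auto
      moreover have "norm (x - z) \<le> norm (x - y) + norm (y - z)"
        by (metis diff_add_cancel add_diff_eq norm_triangle_ineq)
      ultimately show False using u zy by (auto simp: dist_norm)
    qed
    then show "case_prod ?F u = 0" by (auto simp: zy)
  qed
  have "conv (conv f \<phi>) \<psi> x = (\<integral>y. \<integral>z. ?F z y \<partial>lborel \<partial>lborel)"
    by (simp add: conv_def)
  also have "\<dots> = (\<integral>z. \<integral>y. ?F z y \<partial>lborel \<partial>lborel)"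
    by (rule lborel_pair.Fubini_integral[OF int])
  also have "\<dots> = (\<integral>z. f z * conv \<phi> \<psi> (x - z) \<partial>lborel)"
  proof (rule Bochner_Integration.integral_cong[OF refl])
    fix z
    have "continuous_on UNIV (\<lambda>y. \<phi> (y - z) * \<psi> (x - y))"
      by (intro continuous_intros continuous_on_compose2[OF p] continuous_on_compose2[OF q]) auto
    from integral_translate[OF this, of z]
    show "(\<integral>y. ?F z y \<partial>lborel) = f z * conv \<phi> \<psi> (x - z)"
      by (simp add: conv_def mult.assoc algebra_simps)
  qed
  finally show ?thesis by (simp add: conv_def)
qed

section \<open>Mollifiers\<close>

text \<open>
  The bound \<open>r\<close> replaces \<^const>\<open>supp_radius\<close>: an upper bound can be
  enlarged at will, and upper bounds add up under convolution.
\<close>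

definition mollifier :: "real \<Rightarrow> ('a::euclidean_space \<Rightarrow> real) \<Rightarrow> bool" where
  "mollifier r \<phi> \<longleftrightarrow> \<phi> \<in> test_functions \<and> (\<forall>x. \<phi> x \<noteq> 0 \<longrightarrow> norm x \<le> r)"

lemma mollifierD:
  assumes "mollifier r \<phi>"
  shows "continuous_on UNIV \<phi>" "0 \<le> \<phi> x" "integral\<^sup>L lborel \<phi> = 1" "class_C k \<phi>"
    "\<phi> x \<noteq> 0 \<Longrightarrow> norm x \<le> r"
proof -
  show "continuous_on UNIV \<phi>"
    using assms class_C_continuous[of 0 \<phi>] by (auto simp: mollifier_def test_functions_def smooth_def)
  show "\<phi> x \<noteq> 0 \<Longrightarrow> norm x \<le> r" for x
    using assms by (auto simp: mollifier_def)
qed (use assms in \<open>auto simp: mollifier_def test_functions_def smooth_def\<close>)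

lemma mollifier_mono: "mollifier r \<phi> \<Longrightarrow> r \<le> s \<Longrightarrow> mollifier s \<phi>"
  by (force simp: mollifier_def)

lemma supp_subset_cball:
  assumes "mollifier r \<phi>"
  shows "supp \<phi> \<subseteq> cball 0 r"
  unfolding supp_def by (rule closure_minimal) (use mollifierD(5)[OF assms] in auto)

lemma conv_const: "mollifier r \<phi> \<Longrightarrow> conv (\<lambda>_. c) \<phi> x = c"
  using integral_reflect[OF mollifierD(1), of r \<phi> x] mollifierD(3)[of r \<phi>]
  by (simp add: conv_def)

text \<open>
  Closure of mollifiers under convolution is what allows several smoothing requirements to be met
  by one mollifier.
\<close>

lemma mollifier_conv:
  assumes p: "mollifier r \<phi>" and q: "mollifier s \<psi>"
  shows "mollifier (r + s) (conv \<phi> \<psi>)"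
proof -
  have "bounded {x. \<phi> x \<noteq> 0}"
    using mollifierD(5)[OF p] by (auto simp: bounded_iff)
  then obtain a where a: "{x. \<phi> x \<noteq> 0} \<subseteq> cbox (-a) a"
    using bounded_subset_cbox_symmetric by blast
  have sm: "class_C k (conv \<phi> \<psi>)" for k
    by (rule class_C_conv[OF mollifierD(1)[OF p] _ mollifierD(4)[OF q], of "-a" a]) (use a in auto)
  have supp: "norm x \<le> r + s" if "conv \<phi> \<psi> x \<noteq> 0" for x
  proof (rule ccontr)
    assume n: "\<not> norm x \<le> r + s"
    have "\<phi> y * \<psi> (x - y) = 0" for y
    proof (rule ccontr)
      assume "\<phi> y * \<psi> (x - y) \<noteq> 0"
      then have "norm y \<le> r" "norm (x - y) \<le> s"
        using mollifierD(5)[OF p] mollifierD(5)[OF q] by auto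
      with n show False using norm_triangle_sub[of x y] by linarith
    qed
    then have "(\<lambda>y. \<phi> y * \<psi> (x - y)) = (\<lambda>_. 0)" by blast
    then show False using that unfolding conv_def by (metis integral_zero)
  qed
  have "closed (supp (conv \<phi> \<psi>))" by (simp add: supp_def)
  moreover have "bounded (supp (conv \<phi> \<psi>))"
    unfolding supp_def by (rule bounded_closure) (use supp in \<open>auto simp: bounded_iff\<close>)
  ultimately have comp: "compact (supp (conv \<phi> \<psi>))" by (simp add: compact_eq_bounded_closed)
  have nn: "0 \<le> conv \<phi> \<psi> x" for x
    unfolding conv_def using mollifierD(2)[OF p] mollifierD(2)[OF q] by simp
  have "(\<integral>y. conv \<phi> \<psi> y \<partial>lborel) = (\<integral>y. conv \<phi> \<psi> (0 - y) \<partial>lborel)"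
    by (rule integral_reflect[symmetric]) (use class_C_continuous[OF sm[of 0]] in simp)
  \<comment> \<open>the total mass is read off from the convolution with the constant 1, by associativity\<close>
  also have "\<dots> = conv (\<lambda>_. 1) (conv \<phi> \<psi>) 0" by (simp add: conv_def)
  also have "\<dots> = conv (conv (\<lambda>_. 1) \<phi>) \<psi> 0"
    by (rule conv_assoc[symmetric, OF _ mollifierD(1)[OF p] mollifierD(1)[OF q] mollifierD(5)[OF p] mollifierD(5)[OF q]]) auto
  also have "conv (\<lambda>_. 1) \<phi> = (\<lambda>_. 1)" using conv_const[OF p] by auto
  also have "conv (\<lambda>_. 1) \<psi> 0 = 1" by (rule conv_const[OF q])
  finally show ?thesis
    using sm comp nn supp by (auto simp: mollifier_def test_functions_def smooth_def)
qed


section \<open>Convolution near a compact set\<close>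

text \<open>
  The values on \<open>K\<close> of the convolution with a mollifier of radius \<open>r\<close> depend only on the
  values of the function on this closed neighbourhood of \<open>K\<close>.
\<close>

definition thicken :: "real \<Rightarrow> 'a::euclidean_space set \<Rightarrow> 'a set" where
  "thicken r K = (\<Union>x\<in>K. cball x r)"

lemma compact_thicken:
  assumes "compact K"
  shows "compact (thicken r K)"
proof -
  have "thicken r K = {x + y | x y. x \<in> K \<and> y \<in> cball 0 r}"
  proof (intro equalityI subsetI)
    fix z assume "z \<in> thicken r K"
    then obtain x where "x \<in> K" "dist x z \<le> r" by (auto simp: thicken_def)
    then have "x \<in> K" "z - x \<in> cball 0 r" "z = x + (z - x)" by (auto simp: dist_norm norm_minus_commute)
    then show "z \<in> {x + y | x y. x \<in> K \<and> y \<in> cball 0 r}" by blast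
  next
    fix z assume "z \<in> {x + y | x y. x \<in> K \<and> y \<in> cball 0 r}"
    then obtain x y where "x \<in> K" "norm y \<le> r" "z = x + y" by auto
    then show "z \<in> thicken r K" by (auto simp: thicken_def dist_norm intro!: bexI[of _ x])
  qed
  then show ?thesis using compact_sums[OF assms compact_cball[of 0 r]] by simp
qed

lemma thicken_mono: "r \<le> s \<Longrightarrow> K \<subseteq> L \<Longrightarrow> thicken r K \<subseteq> thicken s L"
  by (force simp: thicken_def)

lemma thicken_thicken: "thicken r (thicken s K) \<subseteq> thicken (s + r) K"
proof
  fix z assume "z \<in> thicken r (thicken s K)"
  then obtain y x where "x \<in> K" "dist x y \<le> s" "dist y z \<le> r" by (auto simp: thicken_def)
  moreover have "dist x z \<le> dist x y + dist y z" by (rule dist_triangle)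
  ultimately show "z \<in> thicken (s + r) K" by (force simp: thicken_def)
qed

lemma cball_subset_thicken: "x \<in> K \<Longrightarrow> cball x r \<subseteq> thicken r K"
  by (auto simp: thicken_def)

lemma thicken_singleton: "thicken r {x} = cball x r"
  by (simp add: thicken_def)

lemma subset_thicken: "0 \<le> r \<Longrightarrow> K \<subseteq> thicken r K"
  by (auto simp: thicken_def)

lemma compact_thicken_subset_open:
  assumes "compact K" "open U" "K \<subseteq> U"
  obtains \<epsilon> where "\<epsilon> > 0" "thicken \<epsilon> K \<subseteq> U"
  using compact_subset_open_imp_cball_epsilon_subset[OF assms] unfolding thicken_def by blast

lemma conv_nonzero_dist: "mollifier s \<psi> \<Longrightarrow> \<psi> (x - y) \<noteq> 0 \<Longrightarrow> y \<in> cball x s"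
  by (auto simp: dist_norm dest: mollifierD(5))

lemma conv_cong:
  assumes "mollifier s \<psi>" "\<And>y. y \<in> cball x s \<Longrightarrow> f y = g y"
  shows "conv f \<psi> x = conv g \<psi> x"
proof -
  have "f y * \<psi> (x - y) = g y * \<psi> (x - y)" for y
    using conv_nonzero_dist[OF assms(1)] assms(2) by (cases "\<psi> (x - y) = 0") auto
  then show ?thesis unfolding conv_def by presburger
qed

lemma continuous_extension_compact:
  fixes f :: "'a::euclidean_space \<Rightarrow> real"
  assumes "compact S" "continuous_on S f"
  obtains g where "continuous_on UNIV g" "\<And>x. x \<in> S \<Longrightarrow> g x = f x"
  using Tietze_unbounded[OF assms(2), of UNIV] compact_imp_closed[OF assms(1)]
  by (metis closed_closedin subtopology_UNIV)

lemma integrable_conv: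
  assumes "continuous_on (cball x s) f" "mollifier s \<psi>"
  shows "integrable lborel (\<lambda>y. f y * \<psi> (x - y))"
proof -
  have c: "continuous_on (cball x s) (\<lambda>y. f y * \<psi> (x - y))"
    by (intro continuous_intros assms(1) continuous_on_compose2[OF mollifierD(1)[OF assms(2)]]) auto
  have "(\<lambda>y. indicator (cball x s) y *\<^sub>R (f y * \<psi> (x - y))) = (\<lambda>y. f y * \<psi> (x - y))"
  proof
    fix y show "indicator (cball x s) y *\<^sub>R (f y * \<psi> (x - y)) = f y * \<psi> (x - y)"
      using conv_nonzero_dist[OF assms(2), of x y] by (cases "y \<in> cball x s") auto
  qed
  with borel_integrable_compact[OF compact_cball c] show ?thesis by simp
qed

lemma conv_diff:
  assumes "continuous_on (cball x s) f" "continuous_on (cball x s) g" "mollifier s \<psi>"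
  shows "conv (\<lambda>y. f y - g y) \<psi> x = conv f \<psi> x - conv g \<psi> x"
  using integrable_conv[OF assms(1,3)] integrable_conv[OF assms(2,3)]
  by (simp add: conv_def left_diff_distrib)

text \<open>
  Convolution with a mollifier is an average over the ball of radius \<open>s\<close>.
\<close>

lemma abs_conv_le:
  assumes "continuous_on (cball x s) f" "mollifier s \<psi>" "\<And>y. y \<in> cball x s \<Longrightarrow> \<bar>f y\<bar> \<le> e"
  shows "\<bar>conv f \<psi> x\<bar> \<le> e"
proof -
  have "\<bar>conv f \<psi> x\<bar> \<le> (\<integral>y. \<bar>f y * \<psi> (x - y)\<bar> \<partial>lborel)"
    unfolding conv_def by (rule integral_abs_bound)
  also have "\<dots> \<le> (\<integral>y. e * \<psi> (x - y) \<partial>lborel)"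
  proof (rule integral_mono)
    show "integrable lborel (\<lambda>y. \<bar>f y * \<psi> (x - y)\<bar>)"
      using integrable_conv[OF assms(1,2)] by (rule integrable_abs)
    show "integrable lborel (\<lambda>y. e * \<psi> (x - y))"
      by (rule integrable_conv[OF continuous_on_const assms(2)])
    fix y show "\<bar>f y * \<psi> (x - y)\<bar> \<le> e * \<psi> (x - y)"
      using conv_nonzero_dist[OF assms(2), of x y] assms(3)[of y] mollifierD(2)[OF assms(2), of "x - y"]
      by (cases "\<psi> (x - y) = 0") (auto simp: abs_mult mult_right_mono)
  qed
  also have "\<dots> = conv (\<lambda>_. e) \<psi> x" by (simp add: conv_def)
  also have "\<dots> = e" by (rule conv_const[OF assms(2)])
  finally show ?thesis .
qed

text \<open>
  Only the values of \<open>f\<close> on the compact ball matter, so \<open>f\<close> may be replaced by a continuous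
  extension of its restriction to that ball, for which associativity holds globally.
\<close>

lemma conv_assoc_local:
  assumes f: "continuous_on (cball x (r + s)) f" and p: "mollifier r \<phi>" and q: "mollifier s \<psi>"
  shows "conv (conv f \<phi>) \<psi> x = conv f (conv \<phi> \<psi>) x"
proof -
  obtain g where g: "continuous_on UNIV g" "\<And>y. y \<in> cball x (r + s) \<Longrightarrow> g y = f y"
    using continuous_extension_compact[OF compact_cball f] by metis
  have "conv (conv f \<phi>) \<psi> x = conv (conv g \<phi>) \<psi> x"
  proof (rule conv_cong[OF q], rule conv_cong[OF p])
    fix y z assume yz: "y \<in> cball x s" "z \<in> cball y r"
    then have "z \<in> cball x (r + s)" using dist_triangle[of x z y] by auto
    then show "f z = g z" using g(2) by simp
  qed
  also have "\<dots> = conv g (conv \<phi> \<psi>) x"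
    by (rule conv_assoc[OF g(1) mollifierD(1)[OF p] mollifierD(1)[OF q] mollifierD(5)[OF p] mollifierD(5)[OF q]])
  also have "\<dots> = conv f (conv \<phi> \<psi>) x"
    by (rule conv_cong[OF mollifier_conv[OF p q]]) (rule g(2))
  finally show ?thesis .
qed

text \<open>
  This exchange of two smoothings is behind the diagonal argument below: it
  lets a limit that exists after one smoothing be compared with a limit that exists after another.
\<close>

lemma conv_swap:
  assumes f: "continuous_on (cball x (r + s)) f" and p: "mollifier r \<phi>" and q: "mollifier s \<psi>"
  shows "conv (conv f \<phi>) \<psi> x = conv (conv f \<psi>) \<phi> x"
proof -
  have "continuous_on (cball x (s + r)) f" using f by (simp add: add.commute)
  with conv_assoc_local[OF f p q] conv_assoc_local[OF _ q p, of x f] show ?thesis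
    by (simp add: conv_commute[OF mollifierD(1)[OF p] mollifierD(1)[OF q]])
qed

lemma continuous_on_conv_local:
  assumes "compact K" "continuous_on (thicken s K) f" "mollifier s \<psi>"
  shows "continuous_on K (conv f \<psi>)"
proof -
  obtain g where g: "continuous_on UNIV g" "\<And>y. y \<in> thicken s K \<Longrightarrow> g y = f y"
    using continuous_extension_compact[OF compact_thicken[OF assms(1)] assms(2)] by metis
  have "bounded {x. \<psi> x \<noteq> 0}"
    using mollifierD(5)[OF assms(3)] by (auto simp: bounded_iff)
  then obtain a where a: "{x. \<psi> x \<noteq> 0} \<subseteq> cbox (-a) a"
    using bounded_subset_cbox_symmetric by blast
  have "continuous_on UNIV (conv \<psi> g)"
    by (rule continuous_on_conv[OF mollifierD(1)[OF assms(3)] _ g(1), of "-a" a]) (use a in auto)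
  moreover have "conv f \<psi> x = conv \<psi> g x" if "x \<in> K" for x
  proof -
    have "conv f \<psi> x = conv g \<psi> x"
      by (rule conv_cong[OF assms(3)]) (use g(2) cball_subset_thicken[OF that, of s] in auto)
    then show ?thesis by (simp add: conv_commute[OF g(1) mollifierD(1)[OF assms(3)]])
  qed
  ultimately show ?thesis
    by (metis continuous_on_cong continuous_on_subset subset_UNIV)
qed

section \<open>Uniform limits and mollification\<close>

lemma uniform_limit_conv:
  assumes cont: "\<And>n. continuous_on (thicken s K) (w n)"
    and lim: "uniform_limit (thicken s K) w u sequentially" and q: "mollifier s \<psi>"
  shows "uniform_limit K (\<lambda>n. conv (w n) \<psi>) (conv u \<psi>) sequentially"
proof (rule uniform_limitI)
  fix e :: real assume "e > 0"
  have contu: "continuous_on (thicken s K) u"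
    by (rule uniform_limit_theorem[OF _ lim]) (use cont in auto)
  from uniform_limitD[OF lim half_gt_zero[OF \<open>e > 0\<close>]]
  show "\<forall>\<^sub>F n in sequentially. \<forall>x\<in>K. dist (conv (w n) \<psi> x) (conv u \<psi> x) < e"
  proof eventually_elim
    case (elim n)
    show ?case
    proof
      fix x assume "x \<in> K"
      note sub = cball_subset_thicken[OF this, of s]
      note c1 = continuous_on_subset[OF cont sub] and c2 = continuous_on_subset[OF contu sub]
      have "\<bar>conv (\<lambda>y. w n y - u y) \<psi> x\<bar> \<le> e / 2"
        by (rule abs_conv_le[OF continuous_on_diff[OF c1 c2] q])
           (use elim sub in \<open>force simp: dist_real_def\<close>)
      then show "dist (conv (w n) \<psi> x) (conv u \<psi> x) < e"
        using \<open>e > 0\<close> by (simp add: conv_diff[OF c1 c2 q] dist_real_def)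
    qed
  qed
qed

text \<open>
  Convergence after smoothing with \<open>\<phi>\<close> survives any further smoothing, at the price of
  shrinking the set by the radius of the second mollifier.
\<close>

lemma uniform_limit_conv_conv:
  assumes K: "compact K" and cont: "\<And>n. continuous_on (thicken (r + s) K) (f n)"
    and p: "mollifier r \<phi>" and q: "mollifier s \<psi>"
    and lim: "uniform_limit (thicken s K) (\<lambda>n. conv (f n) \<phi>) u sequentially"
  shows "uniform_limit K (\<lambda>n. conv (f n) (conv \<phi> \<psi>)) (conv u \<psi>) sequentially"
proof -
  have "thicken r (thicken s K) \<subseteq> thicken (r + s) K"
    using thicken_thicken[of r s K] by (simp add: add.commute)
  then have "continuous_on (thicken s K) (conv (f n) \<phi>)" for n
    by (intro continuous_on_conv_local[OF compact_thicken[OF K] _ p] continuous_on_subset[OF cont])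
  from uniform_limit_conv[OF this lim q]
  have "uniform_limit K (\<lambda>n. conv (conv (f n) \<phi>) \<psi>) (conv u \<psi>) sequentially" .
  moreover have "conv (conv (f n) \<phi>) \<psi> x = conv (f n) (conv \<phi> \<psi>) x" if "x \<in> K" for n x
    by (rule conv_assoc_local[OF continuous_on_subset[OF cont cball_subset_thicken[OF that]] p q])
  ultimately show ?thesis
    by (subst uniform_limit_cong'[where g="\<lambda>n. conv (conv (f n) \<phi>) \<psi>" and i="conv u \<psi>"]) auto
qed

lemma uniform_limit_mollify:
  assumes K: "compact K" and t: "t > 0" and cont: "continuous_on (thicken t K) u"
    and p: "\<And>n. mollifier (r n) (\<phi> n)" and r: "r \<longlonglongrightarrow> 0"
  shows "uniform_limit K (\<lambda>n. conv u (\<phi> n)) u sequentially"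
proof (rule uniform_limitI)
  fix e :: real assume e: "e > 0"
  from compact_uniformly_continuous[OF cont compact_thicken[OF K]] half_gt_zero[OF e]
  obtain d where d: "d > 0"
    "\<And>x y. x \<in> thicken t K \<Longrightarrow> y \<in> thicken t K \<Longrightarrow> dist y x < d \<Longrightarrow> dist (u y) (u x) < e / 2"
    unfolding uniformly_continuous_on_def by metis
  have "\<forall>\<^sub>F n in sequentially. r n < min t d"
    using order_tendstoD(2)[OF r, of "min t d"] t d(1) by simp
  then show "\<forall>\<^sub>F n in sequentially. \<forall>x\<in>K. dist (conv u (\<phi> n) x) (u x) < e"
  proof eventually_elim
    case (elim n)
    show ?case
    proof
      fix x assume x: "x \<in> K"
      have sub: "cball x (r n) \<subseteq> thicken t K"
        using cball_subset_thicken[OF x, of t] elim by (meson less_imp_le min.strict_boundedE order_trans subset_cball)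
      have xt: "x \<in> thicken t K" using cball_subset_thicken[OF x, of t] t by auto
      note c = continuous_on_subset[OF cont sub]
      have "\<bar>conv (\<lambda>y. u y - u x) (\<phi> n) x\<bar> \<le> e / 2"
      proof (rule abs_conv_le[OF continuous_on_diff[OF c continuous_on_const] p])
        fix y assume y: "y \<in> cball x (r n)"
        then have "dist y x < d" using elim by (simp add: dist_commute)
        with d(2)[OF xt, of y] y sub show "\<bar>u y - u x\<bar> \<le> e / 2" by (auto simp: dist_real_def)
      qed
      moreover have "conv (\<lambda>y. u y - u x) (\<phi> n) x = conv u (\<phi> n) x - u x"
        by (subst conv_diff[OF c continuous_on_const p]) (simp add: conv_const[OF p])
      ultimately show "dist (conv u (\<phi> n) x) (u x) < e" using e by (simp add: dist_real_def)
    qed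
  qed
qed

text \<open>
  Let \<open>h n\<close> be the limit of the smoothings of \<open>f\<close> by \<open>\<phi> n\<close>, and \<open>u\<close> the limit of
  the smoothings of \<open>f\<close> by one fixed \<open>\<psi>\<close>. Smoothing \<open>h n\<close> by \<open>\<psi>\<close> or \<open>u\<close> by
  \<open>\<phi> n\<close> gives the same function, both being the limit of the double smoothings of
  \<open>f\<close>; and the mollifications of the continuous function \<open>u\<close> by \<open>\<phi> n\<close> converge to \<open>u\<close>.
\<close>

lemma uniform_limit_conv_diagonal:
  assumes K: "compact K" and t: "0 < t"
    and cont: "\<And>k. continuous_on (thicken (s + t) K) (f k)"
    and p: "\<And>n. mollifier (r n) (\<phi> n)" and r: "r \<longlonglongrightarrow> 0"
    and h: "\<And>n. uniform_limit (C n) (\<lambda>k. conv (f k) (\<phi> n)) (h n) sequentially"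
    and C: "\<forall>\<^sub>F n in sequentially. thicken s K \<subseteq> C n"
    and q: "mollifier s \<psi>"
    and u: "uniform_limit (thicken t K) (\<lambda>k. conv (f k) \<psi>) u sequentially"
  shows "uniform_limit K (\<lambda>n. conv (h n) \<psi>) u sequentially"
proof -
  have "thicken s (thicken t K) \<subseteq> thicken (s + t) K"
    using thicken_thicken[of s t K] by (simp add: add.commute)
  then have cu: "continuous_on (thicken t K) (conv (f k) \<psi>)" for k
    by (intro continuous_on_conv_local[OF compact_thicken[OF K] _ q] continuous_on_subset[OF cont])
  have contu: "continuous_on (thicken t K) u"
    by (rule uniform_limit_theorem[OF _ u]) (use cu in auto)
  have "\<forall>\<^sub>F n in sequentially. \<forall>x\<in>K. conv (h n) \<psi> x = conv u (\<phi> n) x"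
    using C order_tendstoD(2)[OF r t]
  proof eventually_elim
    case (elim n)
    show ?case
    proof
      fix x assume x: "x \<in> K"
      have "thicken (r n) (thicken s {x}) \<subseteq> thicken (s + r n) {x}" by (rule thicken_thicken)
      also have "\<dots> \<subseteq> thicken (s + t) K" by (rule thicken_mono) (use elim x in auto)
      finally have "continuous_on (thicken s {x}) (conv (f k) (\<phi> n))" for k
        by (intro continuous_on_conv_local[OF compact_thicken[OF compact_sing] _ p] continuous_on_subset[OF cont])
      moreover have "thicken s {x} \<subseteq> C n" using elim(1) cball_subset_thicken[OF x, of s] by (auto simp: thicken_singleton)
      ultimately have l1: "(\<lambda>k. conv (conv (f k) (\<phi> n)) \<psi> x) \<longlonglongrightarrow> conv (h n) \<psi> x"
        using uniform_limit_conv[OF _ uniform_limit_on_subset[OF h] q, where K="{x}"] by (simp add: thicken_singleton)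
      have sub: "thicken (r n) {x} \<subseteq> thicken t K" by (rule thicken_mono) (use elim x in auto)
      have l2: "(\<lambda>k. conv (conv (f k) \<psi>) (\<phi> n) x) \<longlonglongrightarrow> conv u (\<phi> n) x"
        using uniform_limit_conv[OF continuous_on_subset[OF cu sub] uniform_limit_on_subset[OF u sub] p] by simp
      have "continuous_on (cball x (r n + s)) (f k)" for k
        using continuous_on_subset[OF cont thicken_mono[of "s + r n" "s + t" "{x}" K]] elim(2) x
        by (simp add: thicken_singleton add.commute)
      from conv_swap[OF this p q] l1
      have "(\<lambda>k. conv (conv (f k) \<psi>) (\<phi> n) x) \<longlonglongrightarrow> conv (h n) \<psi> x" by simp
      with l2 show "conv (h n) \<psi> x = conv u (\<phi> n) x" by (rule LIMSEQ_unique[rotated])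
    qed
  qed
  with uniform_limit_mollify[OF K t contu p r] show ?thesis
    by (subst uniform_limit_cong[where g="\<lambda>n. conv u (\<phi> n)" and i=u]) auto
qed


section \<open>Boehmians in terms of single mollifiers\<close>

lemma eventually_mollifier:
  assumes "\<delta> \<in> delta_sequences" "0 < r"
  shows "\<forall>\<^sub>F n in sequentially. mollifier r (\<delta> n)"
proof -
  have "\<forall>\<^sub>F n in sequentially. supp_radius (\<delta> n) < r"
    using assms by (auto simp: delta_sequences_def dest: order_tendstoD)
  then show ?thesis
  proof eventually_elim
    case (elim n)
    have t: "\<delta> n \<in> test_functions" using assms(1) by (auto simp: delta_sequences_def)
    let ?S = "{\<epsilon>. 0 < \<epsilon> \<and> supp (\<delta> n) \<subseteq> ball 0 \<epsilon>}"
    have "bounded (supp (\<delta> n))" using t by (auto simp: test_functions_def compact_imp_bounded)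
    then have "?S \<noteq> {}" using bounded_subset_ballD[of "supp (\<delta> n)" 0] by auto
    with elim obtain \<epsilon> where "\<epsilon> \<in> ?S" "\<epsilon> < r"
      unfolding supp_radius_def by (meson cInf_lessD)
    moreover have "{x. \<delta> n x \<noteq> 0} \<subseteq> supp (\<delta> n)" by (simp add: supp_def closure_subset)
    ultimately have "\<delta> n x \<noteq> 0 \<Longrightarrow> norm x \<le> r" for x by fastforce
    with t show ?case by (simp add: mollifier_def)
  qed
qed

lemma delta_sequencesI:
  assumes p: "\<And>n. mollifier (r n) (\<delta> n)" and r: "\<And>n. 0 < r n" "r \<longlonglongrightarrow> 0"
  shows "\<delta> \<in> delta_sequences"
proof -
  have nn: "0 \<le> supp_radius (\<delta> n) \<and> supp_radius (\<delta> n) \<le> 2 * r n" for n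
  proof -
    let ?S = "{\<epsilon>. 0 < \<epsilon> \<and> supp (\<delta> n) \<subseteq> ball 0 \<epsilon>}"
    \<comment> \<open>the factor 2 passes from the closed ball containing the support to an open one\<close>
    have "2 * r n \<in> ?S" using supp_subset_cball[OF p[of n]] r(1)[of n] by fastforce
    moreover have "bdd_below ?S" by (rule bdd_belowI[of _ 0]) auto
    ultimately show ?thesis unfolding supp_radius_def
      by (auto intro!: cInf_greatest cInf_lower)
  qed
  have "(\<lambda>n. supp_radius (\<delta> n)) \<longlonglongrightarrow> 0"
  proof (rule tendsto_sandwich)
    show "\<forall>\<^sub>F n in sequentially. 0 \<le> supp_radius (\<delta> n)"
      "\<forall>\<^sub>F n in sequentially. supp_radius (\<delta> n) \<le> 2 * r n" using nn by simp_all
    show "(\<lambda>n. 2 * r n) \<longlonglongrightarrow> 0" using tendsto_mult_right_zero[OF r(2)] by simp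
  qed simp
  with p show ?thesis by (simp add: delta_sequences_def mollifier_def)
qed

lemma conv_defined_mollifier:
  assumes "mollifier s \<psi>" "thicken s K \<subseteq> U"
  shows "conv_defined U K \<psi>"
  unfolding conv_defined_def
proof (intro ballI conjI allI impI)
  fix f x y assume f: "f \<in> cont_functions U" and x: "x \<in> K"
  have sub: "cball x s \<subseteq> U" using cball_subset_thicken[OF x] assms(2) by blast
  then show "\<psi> (x - y) \<noteq> 0 \<Longrightarrow> y \<in> U" using conv_nonzero_dist[OF assms(1)] by blast
  show "integrable lborel (\<lambda>y. f y * \<psi> (x - y))"
    by (rule integrable_conv[OF continuous_on_subset[OF _ sub] assms(1)])
       (use f in \<open>auto simp: cont_functions_def\<close>)
qed

text \<open>
  Delta sequences enter the definitions only through their individual terms. The tail of a delta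
  sequence supplies mollifiers of every radius; conversely, mollifiers of radius \<open>1 / (m + 1)\<close>
  make up a delta sequence. The clause on \<^const>\<open>conv_defined\<close> then disappears, since it holds
  as soon as the radius is smaller than the distance from \<open>K\<close> to the complement of \<open>U\<close>.
\<close>

lemma ex_delta_sequence_iff:
  assumes "compact K" "open U" "K \<subseteq> U"
  shows "(\<exists>\<delta>\<in>delta_sequences. \<forall>m. conv_defined U K (\<delta> m) \<longrightarrow> P (\<delta> m)) \<longleftrightarrow>
    (\<forall>r>0. \<exists>\<phi>. mollifier r \<phi> \<and> P \<phi>)"
proof (intro iffI allI impI)
  fix r :: real assume r: "0 < r"
  assume "\<exists>\<delta>\<in>delta_sequences. \<forall>m. conv_defined U K (\<delta> m) \<longrightarrow> P (\<delta> m)"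
  then obtain \<delta> where d: "\<delta> \<in> delta_sequences" "\<And>m. conv_defined U K (\<delta> m) \<Longrightarrow> P (\<delta> m)" by blast
  obtain \<epsilon> where e: "\<epsilon> > 0" "thicken \<epsilon> K \<subseteq> U"
    using compact_thicken_subset_open[OF assms] .
  have "\<forall>\<^sub>F m in sequentially. mollifier (min r \<epsilon>) (\<delta> m)"
    by (rule eventually_mollifier[OF d(1)]) (use r e(1) in simp)
  then obtain m where m: "mollifier (min r \<epsilon>) (\<delta> m)"
    by (meson eventually_happens sequentially_bot)
  have "mollifier r (\<delta> m)" "mollifier \<epsilon> (\<delta> m)" using mollifier_mono[OF m] by simp_all
  then show "\<exists>\<phi>. mollifier r \<phi> \<and> P \<phi>"
    using d(2) conv_defined_mollifier e(2) by blast
next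
  assume "\<forall>r>0. \<exists>\<phi>. mollifier r \<phi> \<and> P \<phi>"
  then have "\<forall>m. \<exists>\<phi>. mollifier (inverse (real (Suc m))) \<phi> \<and> P \<phi>" by simp
  then obtain \<delta> where d: "\<And>m. mollifier (inverse (real (Suc m))) (\<delta> m)" "\<And>m. P (\<delta> m)" by metis
  have "\<delta> \<in> delta_sequences"
    by (rule delta_sequencesI[OF d(1)]) (use LIMSEQ_inverse_real_of_nat in auto)
  with d(2) show "\<exists>\<delta>\<in>delta_sequences. \<forall>m. conv_defined U K (\<delta> m) \<longrightarrow> P (\<delta> m)" by blast
qed

lemma fundamental_sequences_iff:
  assumes "open U"
  shows "f \<in> fundamental_sequences U \<longleftrightarrow> (\<forall>n. f n \<in> cont_functions U) \<and>
    (\<forall>K r. compact K \<longrightarrow> K \<subseteq> U \<longrightarrow> 0 < r \<longrightarrow>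
       (\<exists>\<phi>. mollifier r \<phi> \<and> uniformly_convergent_on K (\<lambda>n. conv (f n) \<phi>)))"
proof -
  have "(\<forall>K. compact K \<and> K \<subseteq> U \<longrightarrow> (\<exists>\<delta>\<in>delta_sequences. \<forall>m. conv_defined U K (\<delta> m) \<longrightarrow>
        uniformly_convergent_on K (\<lambda>n. conv (f n) (\<delta> m)))) \<longleftrightarrow>
      (\<forall>K. compact K \<and> K \<subseteq> U \<longrightarrow> (\<forall>r>0. \<exists>\<phi>. mollifier r \<phi> \<and>
        uniformly_convergent_on K (\<lambda>n. conv (f n) \<phi>)))"
    by (intro all_cong1 imp_cong refl ex_delta_sequence_iff assms) auto
  then show ?thesis unfolding fundamental_sequences_def mem_Collect_eq by blast
qed

lemma boehmian_rel_iff: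
  assumes "open U"
  shows "(f, g) \<in> boehmian_rel U \<longleftrightarrow> f \<in> fundamental_sequences U \<and> g \<in> fundamental_sequences U \<and>
    (\<forall>K r. compact K \<longrightarrow> K \<subseteq> U \<longrightarrow> 0 < r \<longrightarrow>
       (\<exists>\<phi>. mollifier r \<phi> \<and>
          uniform_limit K (\<lambda>n. conv (\<lambda>y. f n y - g n y) \<phi>) (\<lambda>_. 0) sequentially))"
proof -
  have "(\<forall>K. compact K \<and> K \<subseteq> U \<longrightarrow> (\<exists>\<delta>\<in>delta_sequences. \<forall>m. conv_defined U K (\<delta> m) \<longrightarrow>
        uniform_limit K (\<lambda>n. conv (\<lambda>y. f n y - g n y) (\<delta> m)) (\<lambda>_. 0) sequentially)) \<longleftrightarrow>
      (\<forall>K. compact K \<and> K \<subseteq> U \<longrightarrow> (\<forall>r>0. \<exists>\<phi>. mollifier r \<phi> \<and>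
        uniform_limit K (\<lambda>n. conv (\<lambda>y. f n y - g n y) \<phi>) (\<lambda>_. 0) sequentially))"
    by (intro all_cong1 imp_cong refl ex_delta_sequence_iff assms) auto
  then show ?thesis unfolding boehmian_rel_def mem_Collect_eq case_prod_conv by blast
qed

lemma fundamental_continuous: "f \<in> fundamental_sequences U \<Longrightarrow> S \<subseteq> U \<Longrightarrow> continuous_on S (f n)"
  by (auto simp: fundamental_sequences_def cont_functions_def intro: continuous_on_subset)

lemma fundamentalE:
  assumes "open U" "f \<in> fundamental_sequences U" "compact K" "K \<subseteq> U" "0 < r"
  obtains \<phi> u where "mollifier r \<phi>" "uniform_limit K (\<lambda>n. conv (f n) \<phi>) u sequentially"
proof -
  have "\<exists>\<phi>. mollifier r \<phi> \<and> uniformly_convergent_on K (\<lambda>n. conv (f n) \<phi>)"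
    using assms(2-5) unfolding fundamental_sequences_iff[OF assms(1)] by blast
  with that show ?thesis unfolding uniformly_convergent_on_def by blast
qed

lemma boehmian_relE:
  assumes "open U" "(f, g) \<in> boehmian_rel U" "compact K" "K \<subseteq> U" "0 < r"
  obtains \<phi> where "mollifier r \<phi>"
    "uniform_limit K (\<lambda>n. conv (\<lambda>y. f n y - g n y) \<phi>) (\<lambda>_. 0) sequentially"
proof -
  have "\<exists>\<phi>. mollifier r \<phi> \<and>
      uniform_limit K (\<lambda>n. conv (\<lambda>y. f n y - g n y) \<phi>) (\<lambda>_. 0) sequentially"
    using assms(2-5) unfolding boehmian_rel_iff[OF assms(1)] by blast
  with that show ?thesis by blast
qed

lemma conv_zero: "conv (\<lambda>_. 0) \<psi> = (\<lambda>_. 0)"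
  by (simp add: conv_def fun_eq_iff)

lemma boehmian_rel_sym: "(f, g) \<in> boehmian_rel U \<Longrightarrow> (g, f) \<in> boehmian_rel U"
proof -
  have neg: "conv (\<lambda>y. g n y - f n y) \<phi> x = - conv (\<lambda>y. f n y - g n y) \<phi> x" for n \<phi> x and f g :: "nat \<Rightarrow> 'a \<Rightarrow> real"
    by (simp add: conv_def flip: integral_minus)
       (rule Bochner_Integration.integral_cong, auto simp: algebra_simps)
  have "uniform_limit K (\<lambda>n. conv (\<lambda>y. g n y - f n y) \<phi>) (\<lambda>_. 0) sequentially \<longleftrightarrow>
      uniform_limit K (\<lambda>n. conv (\<lambda>y. f n y - g n y) \<phi>) (\<lambda>_. 0) sequentially" for K \<phi>
    unfolding uniform_limit_iff by (subst neg) (simp add: dist_real_def)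
  then show "(f, g) \<in> boehmian_rel U \<Longrightarrow> (g, f) \<in> boehmian_rel U"
    by (simp add: boehmian_rel_def)
qed

text \<open>
  The convolution of a mollifier that makes \<open>f - g\<close> small with one that makes \<open>g - h\<close> small
  serves for both differences.
\<close>

lemma boehmian_rel_trans:
  assumes U: "open U" and fg: "(f, g) \<in> boehmian_rel U" and gh: "(g, h) \<in> boehmian_rel U"
  shows "(f, h) \<in> boehmian_rel U"
proof -
  have fund: "f \<in> fundamental_sequences U" "g \<in> fundamental_sequences U" "h \<in> fundamental_sequences U"
    using fg gh by (auto simp: boehmian_rel_def)
  have "\<exists>\<phi>. mollifier r \<phi> \<and>
      uniform_limit K (\<lambda>n. conv (\<lambda>y. f n y - h n y) \<phi>) (\<lambda>_. 0) sequentially"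
    if K: "compact K" "K \<subseteq> U" and r: "0 < r" for K r
  proof -
    obtain \<epsilon> where e: "\<epsilon> > 0" "thicken \<epsilon> K \<subseteq> U"
      using compact_thicken_subset_open[OF K(1) U K(2)] .
    define s where "s = min r \<epsilon> / 2"
    have s: "0 < s" "s + s \<le> r" "s + s \<le> \<epsilon>" "s \<le> \<epsilon>" using r e(1) by (auto simp: s_def)
    have sub: "thicken (s + s) K \<subseteq> U" "thicken s K \<subseteq> U"
      using thicken_mono[OF s(3) order_refl] thicken_mono[OF s(4) order_refl] e(2) by blast+
    obtain \<phi> where p: "mollifier s \<phi>"
      "uniform_limit (thicken s K) (\<lambda>n. conv (\<lambda>y. f n y - g n y) \<phi>) (\<lambda>_. 0) sequentially"
      by (rule boehmian_relE[OF U fg compact_thicken[OF K(1)] sub(2) s(1)])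
    obtain \<psi> where q: "mollifier s \<psi>"
      "uniform_limit (thicken s K) (\<lambda>n. conv (\<lambda>y. g n y - h n y) \<psi>) (\<lambda>_. 0) sequentially"
      by (rule boehmian_relE[OF U gh compact_thicken[OF K(1)] sub(2) s(1)])
    have m: "mollifier (s + s) (conv \<phi> \<psi>)" by (rule mollifier_conv[OF p(1) q(1)])
    have com: "conv \<psi> \<phi> = conv \<phi> \<psi>"
      by (rule conv_commute[OF mollifierD(1)[OF q(1)] mollifierD(1)[OF p(1)]])
    have c: "continuous_on S (\<lambda>y. f n y - g n y)" "continuous_on S (\<lambda>y. g n y - h n y)"
      if "S \<subseteq> U" for n S
      by (intro continuous_on_diff fundamental_continuous[OF _ that] fund)+
    have "uniform_limit K (\<lambda>n. conv (\<lambda>y. f n y - g n y) (conv \<phi> \<psi>)) (\<lambda>_. 0) sequentially"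
      using uniform_limit_conv_conv[OF K(1) c(1)[OF sub(1)] p(1) q(1) p(2)] by (simp add: conv_zero)
    moreover have "uniform_limit K (\<lambda>n. conv (\<lambda>y. g n y - h n y) (conv \<phi> \<psi>)) (\<lambda>_. 0) sequentially"
      using uniform_limit_conv_conv[OF K(1) c(2)[OF sub(1)] q(1) p(1) q(2)] by (simp add: conv_zero com)
    ultimately have "uniform_limit K (\<lambda>n x. conv (\<lambda>y. f n y - g n y) (conv \<phi> \<psi>) x +
        conv (\<lambda>y. g n y - h n y) (conv \<phi> \<psi>) x) (\<lambda>x. 0 + 0) sequentially"
      by (rule uniform_limit_add)
    moreover have "conv (\<lambda>y. f n y - h n y) (conv \<phi> \<psi>) x = conv (\<lambda>y. f n y - g n y) (conv \<phi> \<psi>) x +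
        conv (\<lambda>y. g n y - h n y) (conv \<phi> \<psi>) x" if "x \<in> K" for n x
    proof -
      have sb: "cball x (s + s) \<subseteq> U" using cball_subset_thicken[OF that] sub(1) by blast
      note c = fundamental_continuous[OF fund(1) sb] fundamental_continuous[OF fund(2) sb]
        fundamental_continuous[OF fund(3) sb]
      show ?thesis
        using conv_diff[OF c(1)[of n] c(2)[of n] m] conv_diff[OF c(2)[of n] c(3)[of n] m]
          conv_diff[OF c(1)[of n] c(3)[of n] m] by linarith
    qed
    ultimately have "uniform_limit K (\<lambda>n. conv (\<lambda>y. f n y - h n y) (conv \<phi> \<psi>)) (\<lambda>_. 0) sequentially"
      by (simp add: uniform_limit_iff)
    with mollifier_mono[OF m s(2)] show ?thesis by blast
  qed
  with fund show ?thesis by (simp add: boehmian_rel_iff[OF U])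
qed

section \<open>Equivalence and restriction\<close>

lemma equiv_boehmian_rel:
  assumes "open U"
  shows "equiv (fundamental_sequences U) (boehmian_rel U)"
proof (rule equivI)
  show "boehmian_rel U \<subseteq> fundamental_sequences U \<times> fundamental_sequences U"
    by (auto simp: boehmian_rel_def)
  show "refl_on (fundamental_sequences U) (boehmian_rel U)"
  proof (rule refl_onI)
    fix f assume f: "f \<in> fundamental_sequences U"
    have "\<exists>\<phi>. mollifier r \<phi> \<and> uniform_limit K (\<lambda>n. conv (\<lambda>y. f n y - f n y) \<phi>) (\<lambda>_. 0) sequentially"
      if K: "compact K" "K \<subseteq> U" "0 < r" for K r
    proof -
      \<comment> \<open>any mollifier will do, and \<open>f\<close> being fundamental provides one\<close>
      obtain \<phi> u where "mollifier r \<phi>" "uniform_limit K (\<lambda>n. conv (f n) \<phi>) u sequentially"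
        by (rule fundamentalE[OF assms f K])
      moreover have "uniform_limit K (\<lambda>n. conv (\<lambda>y. f n y - f n y) \<phi>) (\<lambda>_. 0) sequentially"
        by (simp add: conv_zero uniform_limit_const)
      ultimately show ?thesis by blast
    qed
    with f show "(f, f) \<in> boehmian_rel U" by (simp add: boehmian_rel_iff[OF assms])
  qed
  show "sym (boehmian_rel U)" by (rule symI) (rule boehmian_rel_sym)
  show "trans (boehmian_rel U)" by (rule transI) (rule boehmian_rel_trans[OF assms])
qed

lemma conv_restrict:
  assumes "mollifier s \<psi>" "thicken s K \<subseteq> W" "x \<in> K"
  shows "conv (restrict f W) \<psi> x = conv f \<psi> x"
  by (rule conv_cong[OF assms(1)]) (use cball_subset_thicken[OF assms(3), of s] assms(2) in auto)

lemma conv_restrict_diff: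
  assumes "mollifier s \<psi>" "thicken s K \<subseteq> W" "x \<in> K"
  shows "conv (\<lambda>y. restrict f W y - restrict g W y) \<psi> x = conv (\<lambda>y. f y - g y) \<psi> x"
  by (rule conv_cong[OF assms(1)]) (use cball_subset_thicken[OF assms(3), of s] assms(2) in auto)

lemma restrict_in_cont_functions: "continuous_on W f \<Longrightarrow> restrict f W \<in> cont_functions W"
  by (auto simp: cont_functions_def cong: continuous_on_cong)

lemma restrict_fundamental:
  assumes "open U" "open W" "W \<subseteq> U" "f \<in> fundamental_sequences U"
  shows "(\<lambda>n. restrict (f n) W) \<in> fundamental_sequences W"
  unfolding fundamental_sequences_iff[OF assms(2)]
proof (intro conjI allI impI)
  show "restrict (f n) W \<in> cont_functions W" for n
    by (rule restrict_in_cont_functions) (rule fundamental_continuous[OF assms(4,3)])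
  fix K and r :: real assume K: "compact K" "K \<subseteq> W" and r: "0 < r"
  obtain \<epsilon> where e: "\<epsilon> > 0" "thicken \<epsilon> K \<subseteq> W"
    using compact_thicken_subset_open[OF K(1) assms(2) K(2)] .
  have "K \<subseteq> U" "0 < min r \<epsilon>" using K(2) assms(3) r e(1) by auto
  then obtain \<phi> u where p: "mollifier (min r \<epsilon>) \<phi>"
    and u: "uniform_limit K (\<lambda>n. conv (f n) \<phi>) u sequentially"
    by (rule fundamentalE[OF assms(1,4) K(1)])
  have m: "mollifier r \<phi>" "mollifier \<epsilon> \<phi>" by (rule mollifier_mono[OF p], simp)+
  have "uniform_limit K (\<lambda>n. conv (restrict (f n) W) \<phi>) u sequentially"
    using u by (subst uniform_limit_cong'[where g="\<lambda>n. conv (f n) \<phi>" and i=u])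
      (auto simp: conv_restrict[OF m(2) e(2)])
  with m(1) show "\<exists>\<phi>. mollifier r \<phi> \<and> uniformly_convergent_on K (\<lambda>n. conv (restrict (f n) W) \<phi>)"
    by (auto simp: uniformly_convergent_on_def)
qed

lemma restrict_boehmian_rel:
  assumes "open U" "open W" "W \<subseteq> U" "(f, g) \<in> boehmian_rel U"
  shows "((\<lambda>n. restrict (f n) W), (\<lambda>n. restrict (g n) W)) \<in> boehmian_rel W"
  unfolding boehmian_rel_iff[OF assms(2)]
proof (intro conjI allI impI)
  show "(\<lambda>n. restrict (f n) W) \<in> fundamental_sequences W" "(\<lambda>n. restrict (g n) W) \<in> fundamental_sequences W"
    using assms(4) by (auto simp: boehmian_rel_def intro!: restrict_fundamental[OF assms(1-3)])
  fix K and r :: real assume K: "compact K" "K \<subseteq> W" and r: "0 < r"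
  obtain \<epsilon> where e: "\<epsilon> > 0" "thicken \<epsilon> K \<subseteq> W"
    using compact_thicken_subset_open[OF K(1) assms(2) K(2)] .
  have "K \<subseteq> U" "0 < min r \<epsilon>" using K(2) assms(3) r e(1) by auto
  then obtain \<phi> where p: "mollifier (min r \<epsilon>) \<phi>"
    and u: "uniform_limit K (\<lambda>n. conv (\<lambda>y. f n y - g n y) \<phi>) (\<lambda>_. 0) sequentially"
    by (rule boehmian_relE[OF assms(1,4) K(1)])
  have m: "mollifier r \<phi>" "mollifier \<epsilon> \<phi>" by (rule mollifier_mono[OF p], simp)+
  have "uniform_limit K (\<lambda>n. conv (\<lambda>y. restrict (f n) W y - restrict (g n) W y) \<phi>) (\<lambda>_. 0) sequentially"
    using u by (simp add: uniform_limit_iff conv_restrict_diff[OF m(2) e(2)] del: restrict_apply)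
  with m(1) show "\<exists>\<phi>. mollifier r \<phi> \<and> uniform_limit K
      (\<lambda>n. conv (\<lambda>y. restrict (f n) W y - restrict (g n) W y) \<phi>) (\<lambda>_. 0) sequentially"
    by blast
qed

text \<open>
  Restriction respects equivalence, so the union that defines it is over equal classes.
\<close>

lemma restrict_boehmian_class:
  assumes "open X" "open U" "U \<subseteq> X" "h \<in> fundamental_sequences X"
  shows "restrict_boehmian U (boehmian_rel X `` {h}) = boehmian_rel U `` {\<lambda>n. restrict (h n) U}"
proof -
  have "boehmian_rel U `` {\<lambda>n. restrict (f n) U} = boehmian_rel U `` {\<lambda>n. restrict (h n) U}"
    if "f \<in> boehmian_rel X `` {h}" for f
  proof (rule equiv_class_eq[OF equiv_boehmian_rel[OF assms(2)]])
    have "(f, h) \<in> boehmian_rel X" using that boehmian_rel_sym by auto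
    then show "(\<lambda>n. restrict (f n) U, \<lambda>n. restrict (h n) U) \<in> boehmian_rel U"
      by (rule restrict_boehmian_rel[OF assms(1-3)])
  qed
  moreover have "h \<in> boehmian_rel X `` {h}"
    using equiv_class_self[OF equiv_boehmian_rel[OF assms(1)] assms(4)] .
  ultimately show ?thesis unfolding restrict_boehmian_def by blast
qed


section \<open>Gluing\<close>

text \<open>
  The compact set \<open>K - V\<close> lies in \<open>U\<close> together with a neighbourhood; cut \<open>K\<close> along it.
\<close>

lemma compact_subset_Un_split:
  fixes U V :: "'a::euclidean_space set"
  assumes K: "compact K" "K \<subseteq> U \<union> V" and U: "open U" and V: "open V"
  obtains K1 K2 where "compact K1" "K1 \<subseteq> U" "compact K2" "K2 \<subseteq> V" "K = K1 \<union> K2"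
proof -
  have "compact (K - V)" "K - V \<subseteq> U" using K V by (auto intro: compact_diff)
  then obtain \<epsilon> where e: "\<epsilon> > 0" "thicken \<epsilon> (K - V) \<subseteq> U"
    using compact_thicken_subset_open[OF _ U] by metis
  let ?O = "\<Union>x\<in>K - V. ball x \<epsilon>"
  have "compact (K \<inter> thicken \<epsilon> (K - V))"
    by (intro compact_Int compact_thicken K \<open>compact (K - V)\<close>)
  moreover have "compact (K - ?O)" by (intro compact_diff K) auto
  moreover have "K - ?O \<subseteq> V" using e(1) by fastforce
  moreover have "K = (K \<inter> thicken \<epsilon> (K - V)) \<union> (K - ?O)" by (force simp: thicken_def)
  ultimately show ?thesis using that e(2) by blast
qed

text \<open>
  Being fundamental is a local property: for \<open>K = K1 \<union> K2\<close> with \<open>K1\<close> in \<open>U\<close> and \<open>K2\<close> in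
  \<open>V\<close>, the convolution of a mollifier that works near \<open>K1\<close> with one that works near
  \<open>K2\<close> works on both.
\<close>

lemma fundamental_sequences_Un:
  assumes U: "open U" and V: "open V" and h: "\<And>n. h n \<in> cont_functions (U \<union> V)"
    and hU: "(\<lambda>n. restrict (h n) U) \<in> fundamental_sequences U"
    and hV: "(\<lambda>n. restrict (h n) V) \<in> fundamental_sequences V"
  shows "h \<in> fundamental_sequences (U \<union> V)"
  unfolding fundamental_sequences_iff[OF open_Un[OF U V]]
proof (intro conjI allI impI h)
  fix K and r :: real assume K: "compact K" "K \<subseteq> U \<union> V" and r: "0 < r"
  obtain K1 K2 where K1: "compact K1" "K1 \<subseteq> U" and K2: "compact K2" "K2 \<subseteq> V" and KK: "K = K1 \<union> K2"
    by (rule compact_subset_Un_split[OF K U V])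
  obtain \<epsilon>1 where e1: "\<epsilon>1 > 0" "thicken \<epsilon>1 K1 \<subseteq> U" by (rule compact_thicken_subset_open[OF K1(1) U K1(2)])
  obtain \<epsilon>2 where e2: "\<epsilon>2 > 0" "thicken \<epsilon>2 K2 \<subseteq> V" by (rule compact_thicken_subset_open[OF K2(1) V K2(2)])
  define s where "s = min r (min \<epsilon>1 \<epsilon>2) / 2"
  have s: "0 < s" "s + s \<le> r" "s + s \<le> \<epsilon>1" "s \<le> \<epsilon>1" "s + s \<le> \<epsilon>2" "s \<le> \<epsilon>2"
    using r e1(1) e2(1) by (auto simp: s_def)
  have sub1: "thicken (s + s) K1 \<subseteq> U" "thicken s K1 \<subseteq> U"
    using thicken_mono[OF s(3) order_refl] thicken_mono[OF s(4) order_refl] e1(2) by blast+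
  have sub2: "thicken (s + s) K2 \<subseteq> V" "thicken s K2 \<subseteq> V"
    using thicken_mono[OF s(5) order_refl] thicken_mono[OF s(6) order_refl] e2(2) by blast+
  obtain \<phi> u where p: "mollifier s \<phi>"
    and u: "uniform_limit (thicken s K1) (\<lambda>n. conv (restrict (h n) U) \<phi>) u sequentially"
    by (rule fundamentalE[OF U hU compact_thicken[OF K1(1)] sub1(2) s(1)])
  obtain \<psi> v where q: "mollifier s \<psi>"
    and v: "uniform_limit (thicken s K2) (\<lambda>n. conv (restrict (h n) V) \<psi>) v sequentially"
    by (rule fundamentalE[OF V hV compact_thicken[OF K2(1)] sub2(2) s(1)])
  have m: "mollifier (s + s) (conv \<phi> \<psi>)" by (rule mollifier_conv[OF p q])
  have com: "conv \<psi> \<phi> = conv \<phi> \<psi>"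
    by (rule conv_commute[OF mollifierD(1)[OF q] mollifierD(1)[OF p]])
  have "uniform_limit K1 (\<lambda>n. conv (restrict (h n) U) (conv \<phi> \<psi>)) (conv u \<psi>) sequentially"
    by (rule uniform_limit_conv_conv[OF K1(1) fundamental_continuous[OF hU sub1(1)] p q u])
  then have "uniform_limit K1 (\<lambda>n. conv (h n) (conv \<phi> \<psi>)) (conv u \<psi>) sequentially"
    by (simp add: uniform_limit_iff conv_restrict[OF m sub1(1)])
  \<comment> \<open>the pointwise limit is a limit function for both parts, so that convergence on \<open>K1\<close> and on
    \<open>K2\<close> adds up to convergence on the union\<close>
  then have l1: "uniform_limit K1 (\<lambda>n. conv (h n) (conv \<phi> \<psi>)) (\<lambda>x. lim (\<lambda>n. conv (h n) (conv \<phi> \<psi>) x)) sequentially"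
    by (simp flip: uniformly_convergent_uniform_limit_iff add: uniformly_convergentI)
  have "uniform_limit K2 (\<lambda>n. conv (restrict (h n) V) (conv \<psi> \<phi>)) (conv v \<phi>) sequentially"
    by (rule uniform_limit_conv_conv[OF K2(1) fundamental_continuous[OF hV sub2(1)] q p v])
  then have "uniform_limit K2 (\<lambda>n. conv (h n) (conv \<phi> \<psi>)) (conv v \<phi>) sequentially"
    by (simp add: uniform_limit_iff com conv_restrict[OF m sub2(1)])
  then have "uniform_limit K2 (\<lambda>n. conv (h n) (conv \<phi> \<psi>)) (\<lambda>x. lim (\<lambda>n. conv (h n) (conv \<phi> \<psi>) x)) sequentially"
    by (simp flip: uniformly_convergent_uniform_limit_iff add: uniformly_convergentI)
  from uniform_limit_on_Un[OF l1 this] have "uniformly_convergent_on K (\<lambda>n. conv (h n) (conv \<phi> \<psi>))"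
    unfolding KK by (rule uniformly_convergentI)
  with mollifier_mono[OF m s(2)]
  show "\<exists>\<phi>. mollifier r \<phi> \<and> uniformly_convergent_on K (\<lambda>n. conv (h n) \<phi>)" by blast
qed

text \<open>
  Each of the three mollifiers can be made the first one applied.
\<close>

lemma conv_left_commute_mollifiers:
  assumes "mollifier r \<alpha>" "mollifier s \<beta>" "mollifier t \<gamma>"
  shows "conv \<beta> (conv \<alpha> \<gamma>) = conv \<alpha> (conv \<beta> \<gamma>)" "conv \<gamma> (conv \<alpha> \<beta>) = conv \<alpha> (conv \<beta> \<gamma>)"
proof -
  have as: "conv (conv f g) h = conv f (conv g h)"
    if "mollifier r f" "mollifier s g" "mollifier t h" for r s t and f g h :: "'a \<Rightarrow> real"
    by (rule ext, rule conv_assoc[where r=s and s=t])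
       (use that in \<open>auto intro: mollifierD(1) dest: mollifierD(5)\<close>)
  have co: "conv f g = conv g f" if "mollifier r f" "mollifier s g" for r s and f g :: "'a \<Rightarrow> real"
    by (rule conv_commute[OF mollifierD(1)[OF that(1)] mollifierD(1)[OF that(2)]])
  show "conv \<beta> (conv \<alpha> \<gamma>) = conv \<alpha> (conv \<beta> \<gamma>)"
    using as[OF assms(2,1,3)] as[OF assms] co[OF assms(1,2)] by simp
  show "conv \<gamma> (conv \<alpha> \<beta>) = conv \<alpha> (conv \<beta> \<gamma>)"
    using as[OF assms] co[OF assms(3) mollifier_conv[OF assms(1,2)]] by simp
qed

text \<open>
  One mollifier that smooths both Boehmians to continuous functions, on \<open>K\<close> and on \<open>L\<close>, and for
  which the two functions agree on the overlap. It is the convolution of three: one for \<open>f\<close>, one for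
  \<open>g\<close>, and one that makes \<open>f - g\<close> tend to \<open>0\<close> near \<open>K \<inter> L\<close>. The limits agree
  exactly on \<open>K \<inter> L\<close>, not just approximately, so they paste to a continuous
  function on the compact set \<open>K \<union> L\<close>, which extends continuously.
\<close>

lemma common_regularization:
  assumes U: "open U" and V: "open V"
    and f: "f \<in> fundamental_sequences U" and g: "g \<in> fundamental_sequences V"
    and fg: "((\<lambda>n. restrict (f n) (U \<inter> V)), (\<lambda>n. restrict (g n) (U \<inter> V))) \<in> boehmian_rel (U \<inter> V)"
    and K: "compact K" "K \<subseteq> U" and L: "compact L" "L \<subseteq> V" and r: "0 < r"
  shows "\<exists>\<phi> h. mollifier r \<phi> \<and> h \<in> cont_functions (U \<union> V) \<and>
    uniform_limit K (\<lambda>n. conv (f n) \<phi>) h sequentially \<and>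
    uniform_limit L (\<lambda>n. conv (g n) \<phi>) h sequentially"
proof -
  let ?W = "U \<inter> V"
  let ?M = "K \<inter> L"
  let ?d = "\<lambda>n y. restrict (f n) ?W y - restrict (g n) ?W y"
  have W: "open ?W" using U V by auto
  have M: "compact ?M" "?M \<subseteq> ?W" using K L by (auto intro: compact_Int)
  obtain \<epsilon>1 where e1: "\<epsilon>1 > 0" "thicken \<epsilon>1 K \<subseteq> U" by (rule compact_thicken_subset_open[OF K(1) U K(2)])
  obtain \<epsilon>2 where e2: "\<epsilon>2 > 0" "thicken \<epsilon>2 L \<subseteq> V" by (rule compact_thicken_subset_open[OF L(1) V L(2)])
  \<comment> \<open>three mollifiers of radius \<open>s\<close> are convolved, and their radii add up\<close>
  define s where "s = min r (min \<epsilon>1 \<epsilon>2) / 3"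
  have s: "0 < s" "s + (s + s) \<le> r" "s + (s + s) \<le> \<epsilon>1" "s + (s + s) \<le> \<epsilon>2"
    using r e1(1) e2(1) by (auto simp: s_def)
  have subK: "thicken (s + (s + s)) K \<subseteq> U" "thicken (s + s) K \<subseteq> U"
    using thicken_mono[of _ \<epsilon>1 K K] e1(2) s by (meson order_refl order_trans, smt (verit) order_refl order_trans)
  have subL: "thicken (s + (s + s)) L \<subseteq> V" "thicken (s + s) L \<subseteq> V"
    using thicken_mono[of _ \<epsilon>2 L L] e2(2) s by (meson order_refl order_trans, smt (verit) order_refl order_trans)
  have subM: "thicken a ?M \<subseteq> ?W" if "thicken a K \<subseteq> U" "thicken a L \<subseteq> V" for a
    using that by (auto simp: thicken_def)
  obtain \<alpha> a where al: "mollifier s \<alpha>"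
    and a: "uniform_limit (thicken (s + s) K) (\<lambda>n. conv (f n) \<alpha>) a sequentially"
    by (rule fundamentalE[OF U f compact_thicken[OF K(1)] subK(2) s(1)])
  obtain \<beta> b where be: "mollifier s \<beta>"
    and b: "uniform_limit (thicken (s + s) L) (\<lambda>n. conv (g n) \<beta>) b sequentially"
    by (rule fundamentalE[OF V g compact_thicken[OF L(1)] subL(2) s(1)])
  obtain \<gamma> where ga: "mollifier s \<gamma>"
    and d: "uniform_limit (thicken (s + s) ?M) (\<lambda>n. conv (?d n) \<gamma>) (\<lambda>_. 0) sequentially"
    by (rule boehmian_relE[OF W fg compact_thicken[OF M(1)] subM[OF subK(2) subL(2)] s(1)])
  define \<phi> where "\<phi> = conv \<alpha> (conv \<beta> \<gamma>)"
  have bg: "mollifier (s + s) (conv \<beta> \<gamma>)" and ag: "mollifier (s + s) (conv \<alpha> \<gamma>)" and ab: "mollifier (s + s) (conv \<alpha> \<beta>)"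
    by (rule mollifier_conv[OF be ga], rule mollifier_conv[OF al ga], rule mollifier_conv[OF al be])
  have m: "mollifier (s + (s + s)) \<phi>" unfolding \<phi>_def by (rule mollifier_conv[OF al bg])
  have \<phi>: "\<phi> = conv \<beta> (conv \<alpha> \<gamma>)" "\<phi> = conv \<gamma> (conv \<alpha> \<beta>)"
    using conv_left_commute_mollifiers[OF al be ga] by (simp_all add: \<phi>_def)
  have cf: "continuous_on (thicken (s + (s + s)) K) (f n)" and cg: "continuous_on (thicken (s + (s + s)) L) (g n)" for n
    by (rule fundamental_continuous[OF f subK(1)], rule fundamental_continuous[OF g subL(1)])
  have fW: "(\<lambda>n. restrict (f n) ?W) \<in> fundamental_sequences ?W"
    and gW: "(\<lambda>n. restrict (g n) ?W) \<in> fundamental_sequences ?W"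
    using fg unfolding boehmian_rel_def by blast+
  note subMW = subM[OF subK(1) subL(1)]
  have cd: "continuous_on (thicken (s + (s + s)) ?M) (?d n)" for n
    by (intro continuous_on_diff fundamental_continuous[OF fW subMW] fundamental_continuous[OF gW subMW])
  define p where "p = conv a (conv \<beta> \<gamma>)"
  define q where "q = conv b (conv \<alpha> \<gamma>)"
  have limp: "uniform_limit K (\<lambda>n. conv (f n) \<phi>) p sequentially"
    unfolding p_def \<phi>_def by (rule uniform_limit_conv_conv[OF K(1) cf al bg a])
  have limq: "uniform_limit L (\<lambda>n. conv (g n) \<phi>) q sequentially"
    unfolding q_def \<phi>(1) by (rule uniform_limit_conv_conv[OF L(1) cg be ag b])
  have "uniform_limit ?M (\<lambda>n. conv (?d n) \<phi>) (\<lambda>_. 0) sequentially"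
    using uniform_limit_conv_conv[OF M(1) cd ga ab d] unfolding \<phi>(2) conv_zero .
  then have limd: "uniform_limit ?M (\<lambda>n. conv (\<lambda>y. f n y - g n y) \<phi>) (\<lambda>_. 0) sequentially"
    by (simp add: uniform_limit_iff conv_restrict_diff[OF m subMW] del: restrict_apply)
  have pq: "p x = q x" if x: "x \<in> ?M" for x
  proof -
    have xK: "x \<in> K" and xL: "x \<in> L" using x by auto
    have "conv (\<lambda>y. f n y - g n y) \<phi> x = conv (f n) \<phi> x - conv (g n) \<phi> x" for n
      by (rule conv_diff[OF continuous_on_subset[OF cf cball_subset_thicken[OF xK]]
            continuous_on_subset[OF cg cball_subset_thicken[OF xL]] m])
    with tendsto_uniform_limitI[OF limd x] have "(\<lambda>n. conv (f n) \<phi> x - conv (g n) \<phi> x) \<longlonglongrightarrow> 0" by simp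
    moreover have "(\<lambda>n. conv (f n) \<phi> x - conv (g n) \<phi> x) \<longlonglongrightarrow> p x - q x"
      by (intro tendsto_diff tendsto_uniform_limitI[OF limp xK] tendsto_uniform_limitI[OF limq xL])
    ultimately have "p x - q x = 0" using LIMSEQ_unique by blast
    then show ?thesis by simp
  qed
  have contp: "continuous_on K p"
    by (rule uniform_limit_theorem[OF always_eventually[OF allI] limp])
       (simp_all add: continuous_on_conv_local[OF K(1) cf m])
  have contq: "continuous_on L q"
    by (rule uniform_limit_theorem[OF always_eventually[OF allI] limq])
       (simp_all add: continuous_on_conv_local[OF L(1) cg m])
  have "continuous_on (K \<union> L) (\<lambda>x. if x \<in> K then p x else q x)"
    by (rule continuous_on_cases) (use K L contp contq pq in \<open>auto simp: compact_imp_closed\<close>)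
  then obtain e where e: "continuous_on UNIV e" "\<And>x. x \<in> K \<union> L \<Longrightarrow> e x = (if x \<in> K then p x else q x)"
    by (rule continuous_extension_compact[OF compact_Un[OF K(1) L(1)]]) blast
  define h where "h = restrict e (U \<union> V)"
  have "h \<in> cont_functions (U \<union> V)"
    unfolding h_def by (rule restrict_in_cont_functions[OF continuous_on_subset[OF e(1)]]) simp
  moreover have hp: "h x = p x" if "x \<in> K" for x using e(2)[of x] that K(2) by (auto simp: h_def)
  have hq: "h x = q x" if "x \<in> L" for x using e(2)[of x] that L(2) pq[of x] by (auto simp: h_def)
  have "uniform_limit K (\<lambda>n. conv (f n) \<phi>) h sequentially" using limp by (simp add: uniform_limit_iff hp)
  moreover have "uniform_limit L (\<lambda>n. conv (g n) \<phi>) h sequentially" using limq by (simp add: uniform_limit_iff hq)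
  ultimately show ?thesis using mollifier_mono[OF m s(2)] by blast
qed

text \<open>
  Smoothing by a fixed mollifier sends \<open>f n\<close> and \<open>h n\<close> to sequences with the same limit, by
  \<open>uniform_limit_conv_diagonal\<close>. This shows at once that \<open>h\<close> is fundamental and that it represents the same
  Boehmian as \<open>f\<close>.
\<close>

lemma diagonal_equivalent:
  assumes U: "open U" and f: "f \<in> fundamental_sequences U"
    and C: "\<And>K. compact K \<Longrightarrow> K \<subseteq> U \<Longrightarrow> \<forall>\<^sub>F n in sequentially. K \<subseteq> C n"
    and h: "\<And>n. continuous_on U (h n)"
    and p: "\<And>n. mollifier (r n) (\<phi> n)" and r: "r \<longlonglongrightarrow> 0"
    and lim: "\<And>n. uniform_limit (C n) (\<lambda>k. conv (f k) (\<phi> n)) (h n) sequentially"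
  shows "(f, \<lambda>n. restrict (h n) U) \<in> boehmian_rel U"
proof -
  have key: "\<exists>\<psi> u. mollifier \<rho> \<psi> \<and> uniform_limit K (\<lambda>n. conv (f n) \<psi>) u sequentially \<and>
      uniform_limit K (\<lambda>n. conv (restrict (h n) U) \<psi>) u sequentially \<and>
      uniform_limit K (\<lambda>n. conv (\<lambda>y. f n y - restrict (h n) U y) \<psi>) (\<lambda>_. 0) sequentially"
    if K: "compact K" "K \<subseteq> U" and rho: "0 < \<rho>" for K \<rho>
  proof -
    obtain \<epsilon> where e: "\<epsilon> > 0" "thicken \<epsilon> K \<subseteq> U" by (rule compact_thicken_subset_open[OF K(1) U K(2)])
    define s where "s = min \<rho> \<epsilon> / 2"
    have s: "0 < s" "s \<le> \<rho>" "s + s \<le> \<epsilon>" "s \<le> \<epsilon>" using rho e(1) by (auto simp: s_def)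
    have sub: "thicken (s + s) K \<subseteq> U" "thicken s K \<subseteq> U"
      using thicken_mono[OF s(3) order_refl] thicken_mono[OF s(4) order_refl] e(2) by blast+
    obtain \<psi> u where q: "mollifier s \<psi>"
      and u: "uniform_limit (thicken s K) (\<lambda>n. conv (f n) \<psi>) u sequentially"
      by (rule fundamentalE[OF U f compact_thicken[OF K(1)] sub(2) s(1)])
    have uK: "uniform_limit K (\<lambda>n. conv (f n) \<psi>) u sequentially"
      by (rule uniform_limit_on_subset[OF u subset_thicken]) (use s(1) in simp)
    have "uniform_limit K (\<lambda>n. conv (h n) \<psi>) u sequentially"
      by (rule uniform_limit_conv_diagonal[OF K(1) s(1) fundamental_continuous[OF f sub(1)] p r lim
            C[OF compact_thicken[OF K(1)] sub(2)] q u])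
    then have hK: "uniform_limit K (\<lambda>n. conv (restrict (h n) U) \<psi>) u sequentially"
      by (simp add: uniform_limit_iff conv_restrict[OF q sub(2)])
    have "conv (\<lambda>y. f n y - restrict (h n) U y) \<psi> x = conv (f n) \<psi> x - conv (restrict (h n) U) \<psi> x"
      if "x \<in> K" for n x
    proof (rule conv_diff[OF _ _ q])
      have sb: "cball x s \<subseteq> U" using cball_subset_thicken[OF that, of s] sub(2) by blast
      show "continuous_on (cball x s) (f n)" by (rule fundamental_continuous[OF f sb])
      show "continuous_on (cball x s) (restrict (h n) U)"
        using restrict_in_cont_functions[OF h[of n]] continuous_on_subset[OF _ sb]
        unfolding cont_functions_def by blast
    qed
    with uniform_limit_minus[OF uK hK]
    have "uniform_limit K (\<lambda>n. conv (\<lambda>y. f n y - restrict (h n) U y) \<psi>) (\<lambda>_. 0) sequentially"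
      by (simp add: uniform_limit_iff del: restrict_apply)
    with uK hK mollifier_mono[OF q s(2)] show ?thesis by blast
  qed
  have "(\<lambda>n. restrict (h n) U) \<in> fundamental_sequences U"
    unfolding fundamental_sequences_iff[OF U]
  proof (intro conjI allI impI)
    show "restrict (h n) U \<in> cont_functions U" for n by (rule restrict_in_cont_functions[OF h])
    fix K and \<rho> :: real assume "compact K" "K \<subseteq> U" "0 < \<rho>"
    from key[OF this] show "\<exists>\<psi>. mollifier \<rho> \<psi> \<and> uniformly_convergent_on K (\<lambda>n. conv (restrict (h n) U) \<psi>)"
      unfolding uniformly_convergent_on_def by blast
  qed
  moreover have "\<exists>\<psi>. mollifier \<rho> \<psi> \<and>
      uniform_limit K (\<lambda>n. conv (\<lambda>y. f n y - restrict (h n) U y) \<psi>) (\<lambda>_. 0) sequentially"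
    if "compact K" "K \<subseteq> U" "0 < \<rho>" for K \<rho>
    using key[OF that] by blast
  ultimately show ?thesis unfolding boehmian_rel_iff[OF U] using f by blast
qed

text \<open>
  The terms \<open>h n\<close> are common regularizations of radius \<open>1 / (n + 1)\<close> on the \<open>n\<close>-th
  members of compact exhaustions of \<open>U\<close> and \<open>V\<close>.
\<close>

lemma glue_representatives:
  assumes U: "open U" and V: "open V"
    and f: "f \<in> fundamental_sequences U" and g: "g \<in> fundamental_sequences V"
    and fg: "((\<lambda>n. restrict (f n) (U \<inter> V)), (\<lambda>n. restrict (g n) (U \<inter> V))) \<in> boehmian_rel (U \<inter> V)"
  obtains h where "h \<in> fundamental_sequences (U \<union> V)"
    "(f, \<lambda>n. restrict (h n) U) \<in> boehmian_rel U" "(g, \<lambda>n. restrict (h n) V) \<in> boehmian_rel V"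
proof -
  obtain C where C: "\<And>n. compact (C n)" "\<And>n. C n \<subseteq> U"
      "\<And>n. C n \<subseteq> interior (C (Suc n))" "\<Union>(range C) = U"
      "\<And>K. compact K \<Longrightarrow> K \<subseteq> U \<Longrightarrow> \<exists>N. \<forall>n\<ge>N. K \<subseteq> C n"
    by (rule open_Union_compact_subsets[OF U]) blast
  obtain D where D: "\<And>n. compact (D n)" "\<And>n. D n \<subseteq> V"
      "\<And>n. D n \<subseteq> interior (D (Suc n))" "\<Union>(range D) = V"
      "\<And>K. compact K \<Longrightarrow> K \<subseteq> V \<Longrightarrow> \<exists>N. \<forall>n\<ge>N. K \<subseteq> D n"
    by (rule open_Union_compact_subsets[OF V]) blast
  define r where "r n = inverse (real (Suc n))" for n
  have r: "0 < r n" "r \<longlonglongrightarrow> 0" for n unfolding r_def using LIMSEQ_inverse_real_of_nat by auto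
  have "\<forall>n. \<exists>\<phi> h. mollifier (r n) \<phi> \<and> h \<in> cont_functions (U \<union> V) \<and>
      uniform_limit (C n) (\<lambda>k. conv (f k) \<phi>) h sequentially \<and>
      uniform_limit (D n) (\<lambda>k. conv (g k) \<phi>) h sequentially"
    by (intro allI common_regularization[OF assms] C(1,2) D(1,2) r(1))
  then obtain \<phi> h where p: "\<And>n. mollifier (r n) (\<phi> n)" and h: "\<And>n. h n \<in> cont_functions (U \<union> V)"
    and lf: "\<And>n. uniform_limit (C n) (\<lambda>k. conv (f k) (\<phi> n)) (h n) sequentially"
    and lg: "\<And>n. uniform_limit (D n) (\<lambda>k. conv (g k) (\<phi> n)) (h n) sequentially" by metis
  have ch: "continuous_on U (h n)" "continuous_on V (h n)" for n
    using h[of n] by (auto simp: cont_functions_def intro: continuous_on_subset)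
  have fU: "(f, \<lambda>n. restrict (h n) U) \<in> boehmian_rel U"
    by (rule diagonal_equivalent[OF U f _ ch(1) p r(2) lf]) (use C(5) in \<open>auto simp: eventually_sequentially\<close>)
  have gV: "(g, \<lambda>n. restrict (h n) V) \<in> boehmian_rel V"
    by (rule diagonal_equivalent[OF V g _ ch(2) p r(2) lg]) (use D(5) in \<open>auto simp: eventually_sequentially\<close>)
  have "h \<in> fundamental_sequences (U \<union> V)"
    by (rule fundamental_sequences_Un[OF U V h]) (use fU gV in \<open>auto simp: boehmian_rel_def\<close>)
  with fU gV that show ?thesis by blast
qed

theorem theorem3:
  fixes U V :: "'a::euclidean_space set"
    and F G :: "(nat \<Rightarrow> 'a \<Rightarrow> real) set"
  assumes "open U" and "open V" and "U \<inter> V \<noteq> {}"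
    and "F \<in> boehmians U" and "G \<in> boehmians V"
    and "restrict_boehmian (U \<inter> V) F = restrict_boehmian (U \<inter> V) G"
  shows "\<exists>H\<in>boehmians (U \<union> V). restrict_boehmian U H = F \<and> restrict_boehmian V H = G"
proof -
  let ?W = "U \<inter> V"
  have W: "open ?W" "?W \<subseteq> U" "?W \<subseteq> V" using assms(1,2) by auto
  obtain f where f: "f \<in> fundamental_sequences U" "F = boehmian_rel U `` {f}"
    using assms(4) unfolding boehmians_def by (rule quotientE)
  obtain g where g: "g \<in> fundamental_sequences V" "G = boehmian_rel V `` {g}"
    using assms(5) unfolding boehmians_def by (rule quotientE)
  have "boehmian_rel ?W `` {\<lambda>n. restrict (f n) ?W} = boehmian_rel ?W `` {\<lambda>n. restrict (g n) ?W}"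
    using assms(6) unfolding f(2) g(2)
      restrict_boehmian_class[OF assms(1) W(1,2) f(1)] restrict_boehmian_class[OF assms(2) W(1,3) g(1)] .
  then have "((\<lambda>n. restrict (f n) ?W), (\<lambda>n. restrict (g n) ?W)) \<in> boehmian_rel ?W"
    by (rule eq_equiv_class[OF _ equiv_boehmian_rel[OF W(1)] restrict_fundamental[OF assms(2) W(1,3) g(1)]])
  then obtain h where h: "h \<in> fundamental_sequences (U \<union> V)"
    "(f, \<lambda>n. restrict (h n) U) \<in> boehmian_rel U" "(g, \<lambda>n. restrict (h n) V) \<in> boehmian_rel V"
    by (rule glue_representatives[OF assms(1,2) f(1) g(1)])
  have UV: "open (U \<union> V)" using assms(1,2) by auto
  have "restrict_boehmian U (boehmian_rel (U \<union> V) `` {h}) = F"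
    unfolding f(2) restrict_boehmian_class[OF UV assms(1) Un_upper1 h(1)]
    by (rule equiv_class_eq[OF equiv_boehmian_rel[OF assms(1)] h(2), symmetric])
  moreover have "restrict_boehmian V (boehmian_rel (U \<union> V) `` {h}) = G"
    unfolding g(2) restrict_boehmian_class[OF UV assms(2) Un_upper2 h(1)]
    by (rule equiv_class_eq[OF equiv_boehmian_rel[OF assms(2)] h(3), symmetric])
  moreover have "boehmian_rel (U \<union> V) `` {h} \<in> boehmians (U \<union> V)"
    unfolding boehmians_def by (rule quotientI[OF h(1)])
  ultimately show ?thesis by blast
qed

end
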